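(* Assume that $$1\le\alpha,\beta,s,a,t\le\infty,\qquad 2<r\le\infty,\qquad 0\le\theta\le1,$$ where these exponents satisfy $$\frac1a+\frac1t=\frac{\beta-1}{\beta}$$ and $$\frac{1}{(r-1)\alpha}+\frac{\theta}{\alpha}=\frac{1-\theta}{s(\alpha-1)}.$$ Then, for functions $\phi,f,g$ on $\mathbb{R}^3$, the following estimate holds: $$\left|\int_{\mathbb{R}^3}\phi fg\,dx_1dx_2dx_3\right|\le C\,\big\|\,\|\partial_3\phi\|_{L^\alpha_{x_3}}\big\|_{L^\beta_{x_1,x_2}}^{\frac1r}\,\big\|\,\|\partial_3\phi\|_{L^\alpha_{x_3}}\big\|_{L^{\theta(r-1)t}_{x_1,x_2}}^{\frac{\theta(r-1)}{r}}\,\big\|\,\|\phi\|_{L^s_{x_3}}\big\|_{L^{(1-\theta)(r-1)a}_{x_1,x_2}}^{\frac{(1-\theta)(r-1)}{r}}\,\|f\|_{L^2}^{\frac{r-2}{r}}\,\|\partial_1f\|_{L^2}^{\frac1r}\,\|\partial_2f\|_{L^2}^{\frac1r}\,\|g\|_{L^2}.$$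
   Context: Here $\partial_i=\partial_{x_i}$ denotes the partial derivative with respect to $x_i$ for $(x_1,x_2,x_3)\in\mathbb{R}^3$, $\|\cdot\|_{L^2}$ is the norm of $L^2(\mathbb{R}^3)$, and $C$ is a constant independent of $\phi,f,g$. For a function $h$ on $\mathbb{R}^3$, $\big\|\,\|h\|_{L^{p}_{x_3}}\big\|_{L^{q}_{x_1,x_2}}$ is obtained by first taking the $L^p(\mathbb{R})$ norm of $h(x_1,x_2,\cdot)$ in the variable $x_3$, and then the $L^q(\mathbb{R}^2)$ norm of the resulting function of $(x_1,x_2)$.
   Formalization: φ is C¹ in x₃, f is C¹ in x₁,x₂, all norms finite. For α=1 or ∞ the second relation is multiplied by α−1; for α=1, φ→0 as |x₃|→∞ is assumed. For θ=0 or 1 the undefined L⁰ factor is the measure of the support to the power 1/(rt) or 1/(ra). *)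

theory Defs
  imports "HOL-Analysis.Analysis" "HOL-Probability.Essential_Supremum"
begin

text \<open>Three-dimensional space is \<^typ>\<open>real \<times> real \<times> real\<close>, with points \<open>(x1, x2, x3)\<close>.
  Integrability exponents are extended nonnegative reals, so that \<open>1 / \<infinity> = 0\<close>.\<close>

type_synonym R3 = "real \<times> real \<times> real"

definition e1 :: R3 where "e1 = (1, 0, 0)"
definition e2 :: R3 where "e2 = (0, 1, 0)"
definition e3 :: R3 where "e3 = (0, 0, 1)"

definition partial :: "R3 \<Rightarrow> (R3 \<Rightarrow> real) \<Rightarrow> R3 \<Rightarrow> real" where
  "partial e h x = deriv (\<lambda>u. h (x + u *\<^sub>R e)) 0"

definition C1_along :: "R3 \<Rightarrow> (R3 \<Rightarrow> real) \<Rightarrow> bool" where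
  "C1_along e h \<longleftrightarrow> continuous_on UNIV h
     \<and> (\<forall>x. (\<lambda>u. h (x + u *\<^sub>R e)) differentiable (at 0))
     \<and> continuous_on UNIV (partial e h)"

text \<open>\<open>x\<close> to the power \<open>q\<close>, for finite \<open>q\<close>. Here \<open>x\<close> to the power \<open>0\<close> is \<open>1\<close>, also for
  \<open>x = 0\<close> (where \<open>powr\<close> gives \<open>0\<close>) and for \<open>x = \<infinity>\<close>.\<close>

definition epow :: "ennreal \<Rightarrow> ennreal \<Rightarrow> ennreal" where
  "epow x q = (if q = 0 then 1 else if x = \<infinity> then \<infinity>
               else ennreal (enn2real x powr enn2real q))"

text \<open>The \<open>L\<^sup>p\<close> (quasi-)norm, \<open>0 < p \<le> \<infinity>\<close>, of a function with values in \<open>[0, \<infinity>]\<close>; these are the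
  values taken by the inner norm of a mixed norm.\<close>

definition Lnorm :: "'a measure \<Rightarrow> ennreal \<Rightarrow> ('a \<Rightarrow> ennreal) \<Rightarrow> ennreal" where
  "Lnorm M p h = (if p = \<infinity> then esssup M h
                  else epow (\<integral>\<^sup>+ x. epow (h x) p \<partial>M) (1 / p))"

definition L2norm :: "(R3 \<Rightarrow> real) \<Rightarrow> ennreal" where
  "L2norm h = Lnorm lebesgue 2 (\<lambda>x. ennreal \<bar>h x\<bar>)"

definition norm_x3 :: "ennreal \<Rightarrow> (R3 \<Rightarrow> real) \<Rightarrow> real \<times> real \<Rightarrow> ennreal" where
  "norm_x3 p h = (\<lambda>(x1, x2). Lnorm lebesgue p (\<lambda>x3. ennreal \<bar>h (x1, x2, x3)\<bar>))"

definition norm_x12 :: "ennreal \<Rightarrow> (real \<times> real \<Rightarrow> ennreal) \<Rightarrow> ennreal" where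
  "norm_x12 q H = Lnorm lebesgue q H"

text \<open>The quotient \<open>(p - k) / p\<close>, with its limit \<open>1\<close> as the value at \<open>p = \<infinity>\<close>
  (in \<^typ>\<open>ennreal\<close> the quotient \<open>\<infinity> / \<infinity>\<close> is \<open>0\<close>).\<close>

definition quot_minus :: "ennreal \<Rightarrow> ennreal \<Rightarrow> ennreal" where
  "quot_minus p k = (if p = \<infinity> then 1 else (p - k) / p)"

text \<open>The power of order \<open>c (r - 1) / r\<close> of the norm of \<open>H\<close> in \<open>L\<close> with exponent \<open>c (r - 1) t\<close>.
  For \<open>c = 0\<close> the norm would have exponent \<open>0\<close>. As the factor is
  \<open>(\<integral> H\<^bsup>c (r - 1) t\<^esup>)\<^bsup>1 / (r t)\<^esup>\<close> for finite \<open>r\<close>, \<open>t\<close>, the case \<open>c = 0\<close> is read as the limit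
  \<open>c \<rightarrow> 0\<close>, namely the measure of the set where \<open>H \<noteq> 0\<close>, to the power \<open>1 / (r t)\<close>.
  For \<open>t = \<infinity>\<close> or \<open>r = \<infinity>\<close> this is \<open>1\<close>. (Replacing it by \<open>1\<close> for finite \<open>r\<close>, \<open>t\<close> as well would
  break the invariance of the estimate under dilations in \<open>(x1, x2)\<close>.)\<close>

definition norm_x12_pow :: "ennreal \<Rightarrow> ennreal \<Rightarrow> ennreal \<Rightarrow> (real \<times> real \<Rightarrow> ennreal) \<Rightarrow> ennreal" where
  "norm_x12_pow c r t H =
     (if c = 0 then epow (emeasure lebesgue {y. H y \<noteq> 0}) (1 / (r * t))
      else epow (norm_x12 (c * (r - 1) * t) H) (c * quot_minus r 1))"

text \<open>The relation
  \<open>1 / ((r - 1) \<alpha>) + \<theta> / \<alpha> = (1 - \<theta>) / (s (\<alpha> - 1))\<close>.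
  For \<open>\<alpha> = 1\<close> its right-hand side is a division by \<open>0\<close>, and for \<open>\<alpha> = \<infinity>\<close> all its terms vanish.
  At these two values it is read after multiplication by \<open>\<alpha> - 1\<close>.
  The lemma below shows that for the other \<open>\<alpha>\<close> this changes nothing.\<close>

definition exponent_relation :: "ennreal \<Rightarrow> ennreal \<Rightarrow> ennreal \<Rightarrow> real \<Rightarrow> bool" where
  "exponent_relation r \<alpha> s \<theta> \<longleftrightarrow>
     (if 1 < \<alpha> \<and> \<alpha> < \<infinity>
      then 1 / ((r - 1) * \<alpha>) + ennreal \<theta> / \<alpha> = ennreal (1 - \<theta>) / (s * (\<alpha> - 1))
      else (1 / (r - 1) + ennreal \<theta>) * quot_minus \<alpha> 1 = ennreal (1 - \<theta>) / s)"

lemma exponent_relation_iff: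
  assumes "1 \<le> \<alpha>" "1 \<le> s" "2 < r" "0 \<le> \<theta>" "\<theta> \<le> 1"
  shows "exponent_relation r \<alpha> s \<theta> \<longleftrightarrow>
    (1 / (r - 1) + ennreal \<theta>) * quot_minus \<alpha> 1 = ennreal (1 - \<theta>) / s"
proof (cases "1 < \<alpha> \<and> \<alpha> < \<infinity>")
  case True
  define m where "m = \<alpha> - 1"
  have m: "m \<noteq> 0" "m \<noteq> top"
    using True by (auto simp: m_def diff_eq_0_iff_ennreal)
  have a: "\<alpha> \<noteq> 0" "\<alpha> \<noteq> top" using True by auto
  have r: "r - 1 \<noteq> 0"
  proof -
    have "1 < r" using assms(3)
      by (meson one_less_numeral_iff order.strict_trans semiring_norm(76))
    then show ?thesis by (auto simp: diff_eq_0_iff_ennreal)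
  qed
  have s: "s \<noteq> 0" using assms(2) by auto
  have l: "m * (1 / ((r - 1) * \<alpha>) + ennreal \<theta> / \<alpha>) = (1 / (r - 1) + ennreal \<theta>) * (m / \<alpha>)"
    using ennreal_inverse_mult'[of \<alpha> "r - 1"] r a
    by (simp add: divide_ennreal_def zero_less_iff_neq_zero algebra_simps)
  have rr: "m * (ennreal (1 - \<theta>) / (s * m)) = ennreal (1 - \<theta>) / s"
  proof -
    have "m * (ennreal (1 - \<theta>) / (s * m)) = ennreal (1 - \<theta>) * inverse s * (m * inverse m)"
      using ennreal_inverse_mult'[of m s] m s
      by (simp add: divide_ennreal_def zero_less_iff_neq_zero algebra_simps)
    then show ?thesis
      using m ennreal_divide_self[of m] by (simp add: divide_ennreal_def less_top)
  qed
  have q: "quot_minus \<alpha> 1 = m / \<alpha>" using a by (simp add: quot_minus_def m_def)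
  have "x = y \<longleftrightarrow> m * x = m * y" for x y
    using m ennreal_mult_cancel_left[of m x y] by auto
  from this[of "1 / ((r - 1) * \<alpha>) + ennreal \<theta> / \<alpha>" "ennreal (1 - \<theta>) / (s * m)"] show ?thesis
    using True unfolding exponent_relation_def l rr q by (simp add: m_def)
qed (auto simp: exponent_relation_def)

end

theory Submission
  imports Defs
begin

text \<open>
  Write \<open>A = \<parallel>\<partial>\<^sub>3\<phi>\<parallel>\<close> and \<open>S = \<parallel>\<phi>\<parallel>\<close> for the inner norms, in \<open>L\<^sup>\<alpha>\<close> and \<open>L\<^sup>s\<close> of \<open>x\<^sub>3\<close>, which are
  functions of \<open>y = (x\<^sub>1, x\<^sub>2)\<close>, and put \<open>\<rho> = 1 / r\<close>, so that \<open>0 \<le> \<rho> < 1 / 2\<close> also covers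
  \<open>r = \<infinity>\<close>. By Cauchy-Schwarz it is enough to bound \<open>\<phi> f\<close> in \<open>L\<^sup>2\<close>. Three facts give this.

  First, on almost every line parallel to the \<open>x\<^sub>3\<close> axis the function \<open>\<phi>\<close> takes arbitrarily small
  values, because it lies in \<open>L\<^sup>s\<close> with \<open>s < \<infinity>\<close> or tends to \<open>0\<close> (apart from endpoint cases, in which
  \<open>S\<close> itself is the supremum of \<open>\<bar>\<phi>\<bar>\<close>). Integrating the derivative of \<open>\<bar>\<phi>\<bar>\<^sup>p\<close> and applying
  Hoelder gives \<open>sup \<bar>\<phi>\<bar> \<le> C A\<^sup>\<mu> S\<^bsup>1 - \<mu>\<^esup>\<close> (\<open>sup_interpolation\<close>) whenever
  \<open>\<mu> (1 - 1 / \<alpha>) = (1 - \<mu>) / s\<close>. With \<open>\<mu> = \<rho> + \<theta> (1 - \<rho>)\<close>, and hence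
  \<open>1 - \<mu> = (1 - \<theta>) (1 - \<rho>)\<close>, this is the relation between \<open>r\<close>, \<open>\<alpha>\<close>, \<open>s\<close> and \<open>\<theta>\<close>
  multiplied by \<open>(\<alpha> - 1) (1 - \<rho>)\<close>. So the three factors with \<open>\<phi>\<close> on the right-hand side of the
  estimate are obtained from the single bound
  \<open>\<bar>\<phi>(y, x\<^sub>3)\<bar> \<le> C A(y)\<^sup>\<rho> A(y)\<^bsup>\<theta> (1 - \<rho>)\<^esup> S(y)\<^bsup>(1 - \<theta>) (1 - \<rho>)\<^esup>\<close>,
  whose right-hand side is independent of \<open>x\<^sub>3\<close> (\<open>slice_sup_bound\<close>, where for \<open>\<theta> = 0\<close> and
  \<open>\<theta> = 1\<close> the factor with exponent \<open>0\<close> is a power of an indicator function).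

  Second, in the plane an anisotropic Ladyzhenskaya inequality holds for every finite exponent
  \<open>2 / (1 - 2 \<rho>)\<close> (\<open>planar_interpolation\<close>): bounding \<open>\<bar>h\<bar>\<^bsup>m + 1\<^esup>\<close> by an integral over a line in
  each of the two directions and multiplying the bounds raises the exponent from \<open>2 m\<close> to
  \<open>2 m + 2\<close>, and Hoelder interpolates between the even integers.

  Third, \<open>\<integral> \<phi>\<^sup>2 f\<^sup>2\<close> is computed with \<open>x\<^sub>3\<close> as the outer variable
  (\<open>square_integral_product_bound\<close>). As the bound on \<open>\<bar>\<phi>\<bar>\<close> is the same on all the planes
  \<open>x\<^sub>3 = const\<close>, Hoelder in \<open>y\<close> splits off its norms, which is where the relation
  \<open>1 / a + 1 / t = 1 - 1 / \<beta>\<close> enters; the planar inequality applies to \<open>f\<close> on each plane, and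
  Hoelder in \<open>x\<^sub>3\<close> with exponents \<open>1 / (1 - 2 \<rho>)\<close>, \<open>1 / \<rho>\<close>, \<open>1 / \<rho>\<close> collects the norms of \<open>f\<close>,
  \<open>\<partial>\<^sub>1f\<close>, \<open>\<partial>\<^sub>2f\<close>.

  All integrals are taken in \<open>[0, \<infinity>]\<close>, with powers for which \<open>x\<close> to the power \<open>0\<close> is \<open>1\<close>. A factor
  whose norm has infinite exponent then enters the Hoelder inequality with weight \<open>0\<close>
  (\<open>Lnorm_majorant\<close>, \<open>norm_x12_pow_majorant\<close>), and the endpoint values of the exponents need
  few separate arguments.
\<close>

section \<open>Real powers of extended nonnegative numbers\<close>

text \<open>The powers \<^const>\<open>epow\<close> with a real exponent, for which laws of exponents such as
  \<open>rpow_rpow\<close> involve only real arithmetic.\<close>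

definition rpow :: "ennreal \<Rightarrow> real \<Rightarrow> ennreal" (infixr "\<up>" 80) where
  "x \<up> w = (if w = 0 then 1 else if x = \<infinity> then \<infinity> else ennreal (enn2real x powr w))"

lemma epow_eq_rpow: "0 \<le> w \<Longrightarrow> epow x (ennreal w) = x \<up> w"
  by (simp add: epow_def rpow_def)

lemma rpow_0 [simp]: "x \<up> 0 = 1" by (simp add: rpow_def)

lemma rpow_1 [simp]: "x \<up> 1 = x" by (auto simp: rpow_def less_top)

lemma one_rpow [simp]: "1 \<up> w = 1" by (simp add: rpow_def)

lemma zero_rpow: "w \<noteq> 0 \<Longrightarrow> 0 \<up> w = 0" by (simp add: rpow_def)

lemma top_rpow: "w \<noteq> 0 \<Longrightarrow> top \<up> w = top" by (simp add: rpow_def)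

lemma ennreal_rpow: "0 \<le> x \<Longrightarrow> w \<noteq> 0 \<Longrightarrow> ennreal x \<up> w = ennreal (x powr w)"
  by (simp add: rpow_def)

lemma rpow_eq_0_iff: "w \<noteq> 0 \<Longrightarrow> x \<up> w = 0 \<longleftrightarrow> x = 0"
  by (cases x) (auto simp: rpow_def)

lemma rpow_less_top: "x < \<infinity> \<Longrightarrow> x \<up> w < \<infinity>"
  by (auto simp: rpow_def less_top)

lemma rpow_less_top_iff: "w \<noteq> 0 \<Longrightarrow> x \<up> w < top \<longleftrightarrow> x < top"
  by (auto simp: rpow_def less_top)

lemma rpow_mono: "x \<le> y \<Longrightarrow> 0 \<le> w \<Longrightarrow> x \<up> w \<le> y \<up> w"
  by (cases x; cases y) (auto simp: rpow_def top_unique intro!: ennreal_leI powr_mono2)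

lemma rpow_mult: "(x * y) \<up> w = x \<up> w * y \<up> w"
  by (cases x; cases y) (auto simp: rpow_def powr_mult ennreal_mult[symmetric]
       ennreal_mult_top ennreal_top_mult)

lemma rpow_rpow: "(x \<up> v) \<up> w = x \<up> (v * w)"
  by (cases x) (auto simp: rpow_def powr_powr)

lemma rpow_add: "0 \<le> v \<Longrightarrow> 0 \<le> w \<Longrightarrow> x \<up> (v + w) = x \<up> v * x \<up> w"
  by (cases x) (auto simp: rpow_def powr_add ennreal_mult[symmetric])

lemma rpow_add': "0 \<le> v \<Longrightarrow> 0 \<le> w \<Longrightarrow> v + w = t \<Longrightarrow> x \<up> v * x \<up> w = x \<up> t"
  by (metis rpow_add)

lemma rpow_measurable [measurable]:
  assumes [measurable]: "f \<in> borel_measurable M"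
  shows "(\<lambda>x. f x \<up> w) \<in> borel_measurable M"
  unfolding rpow_def by measurable

section \<open>Hoelder's inequality with weights\<close>

lemma rpow_Young:
  assumes "0 < w" "w < 1"
  shows "x \<up> w * y \<up> (1 - w) \<le> ennreal w * x + ennreal (1 - w) * y"
proof (cases "x = \<infinity> \<or> y = \<infinity>")
  case True
  then have "ennreal w * x + ennreal (1 - w) * y = top" using assms by (auto simp: ennreal_mult_top)
  show ?thesis unfolding \<open>_ = top\<close> by (rule top_greatest)
next
  case False
  then obtain a b where "x = ennreal a" "y = ennreal b" "0 \<le> a" "0 \<le> b"
    by (metis ennreal_cases infinity_ennreal_def)
  moreover have "a powr w * b powr (1 - w) \<le> w * a + (1 - w) * b"
    using calculation assms Youngs_inequality_0[of w "1 - w" a b] by (cases "a = 0 \<or> b = 0") auto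
  ultimately show ?thesis using assms
    by (simp add: ennreal_rpow ennreal_mult[symmetric] ennreal_plus[symmetric] ennreal_leI del: ennreal_plus)
qed

text \<open>For \<open>0 < w < 1\<close> this is Young's inequality applied to \<open>u / \<integral>u\<close> and \<open>v / \<integral>v\<close>. If one of the integrals is \<open>0\<close>, both sides
  vanish; if one is infinite and neither is \<open>0\<close>, the right-hand side is infinite.\<close>

lemma Hoelder_weighted:
  assumes [measurable]: "u \<in> borel_measurable M" "v \<in> borel_measurable M"
    and w: "0 \<le> w" "w \<le> 1"
  shows "(\<integral>\<^sup>+x. u x \<up> w * v x \<up> (1 - w) \<partial>M) \<le> (\<integral>\<^sup>+x. u x \<partial>M) \<up> w * (\<integral>\<^sup>+x. v x \<partial>M) \<up> (1 - w)"
proof -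
  define U V where "U = (\<integral>\<^sup>+x. u x \<partial>M)" and "V = (\<integral>\<^sup>+x. v x \<partial>M)"
  consider "w = 0" | "w = 1" | "0 < w" "w < 1" using w by linarith
  then show ?thesis
  proof cases
    case 3
    then have w0: "w \<noteq> 0" "1 - w \<noteq> 0" by auto
    have zero: ?thesis if "U = 0 \<or> V = 0"
    proof -
      have "AE x in M. u x = 0 \<or> v x = 0"
        using that unfolding U_def V_def by (auto simp: nn_integral_0_iff_AE)
      then have "AE x in M. u x \<up> w * v x \<up> (1 - w) = 0"
        by eventually_elim (use w0 in \<open>auto simp: zero_rpow\<close>)
      then have "(\<integral>\<^sup>+x. u x \<up> w * v x \<up> (1 - w) \<partial>M) = 0"
        by (subst nn_integral_0_iff_AE) auto
      then show ?thesis by simp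
    qed
    have inf: ?thesis if "U \<noteq> 0" "V \<noteq> 0" "U = \<infinity> \<or> V = \<infinity>"
    proof -
      have "U \<up> w * V \<up> (1 - w) = \<infinity>"
        using that w0 by (auto simp: top_rpow rpow_eq_0_iff ennreal_mult_top ennreal_top_mult)
      then show ?thesis by (simp add: U_def V_def)
    qed
    have fin: ?thesis if "U \<noteq> 0" "V \<noteq> 0" "U \<noteq> \<infinity>" "V \<noteq> \<infinity>"
    proof -
      have mi: "U * inverse U = 1" "V * inverse V = 1"
        using that ennreal_divide_self[of U] ennreal_divide_self[of V]
        by (auto simp: divide_ennreal_def less_top)
      have "u x \<up> w * v x \<up> (1 - w)
          \<le> (U \<up> w * V \<up> (1 - w)) * (ennreal w * (u x * inverse U) + ennreal (1 - w) * (v x * inverse V))" for x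
      proof -
        have "u x = U * (u x * inverse U)" "v x = V * (v x * inverse V)"
          using mi by (metis mult.left_commute mult.right_neutral)+
        then have "u x \<up> w * v x \<up> (1 - w) = (U * (u x * inverse U)) \<up> w * (V * (v x * inverse V)) \<up> (1 - w)"
          by simp
        also have "\<dots> = (U \<up> w * V \<up> (1 - w)) * ((u x * inverse U) \<up> w * (v x * inverse V) \<up> (1 - w))"
          by (subst (1 2) rpow_mult) (simp add: ac_simps)
        finally show ?thesis using rpow_Young[OF 3] by (metis mult_left_mono zero_le)
      qed
      then have "(\<integral>\<^sup>+x. u x \<up> w * v x \<up> (1 - w) \<partial>M)
        \<le> (\<integral>\<^sup>+x. (U \<up> w * V \<up> (1 - w)) * (ennreal w * (u x * inverse U) + ennreal (1 - w) * (v x * inverse V)) \<partial>M)"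
        by (intro nn_integral_mono)
      also have "\<dots> = (U \<up> w * V \<up> (1 - w)) * (ennreal w * (U * inverse U) + ennreal (1 - w) * (V * inverse V))"
        by (simp add: nn_integral_cmult nn_integral_multc nn_integral_add U_def V_def)
      also have "ennreal w * (U * inverse U) + ennreal (1 - w) * (V * inverse V) = 1"
        using mi 3 by (simp add: ennreal_plus[symmetric] del: ennreal_plus)
      finally show ?thesis by (simp add: U_def V_def)
    qed
    show ?thesis using zero inf fin by blast
  qed auto
qed

lemma prod_list_rpow:
  "prod_list (map (\<lambda>(u, w). f u \<up> g w) xs) \<up> v = prod_list (map (\<lambda>(u, w). f u \<up> (g w * v)) xs)"
  by (induction xs) (auto simp: rpow_mult rpow_rpow)

lemma prod_list_rpow_measurable:
  assumes "\<And>u w. (u, w) \<in> set xs \<Longrightarrow> u \<in> borel_measurable M"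
  shows "(\<lambda>x. prod_list (map (\<lambda>(u, w). u x \<up> f w) xs)) \<in> borel_measurable M"
  using assms by (induction xs) (auto intro!: borel_measurable_times_ennreal rpow_measurable)

text \<open>Dividing by the total weight \<open>W\<close> makes the claim inductive: with \<open>W'\<close> the weight of the tail, the
  product over the tail is a power \<open>W' / W\<close> of the product in the induction hypothesis.\<close>

lemma Hoelder_list_scaled:
  assumes "\<And>u w. (u, w) \<in> set xs \<Longrightarrow> u \<in> borel_measurable M \<and> 0 \<le> w"
    and "sum_list (map snd xs) = W" "0 < W"
  shows "(\<integral>\<^sup>+x. prod_list (map (\<lambda>(u, w). u x \<up> (w / W)) xs) \<partial>M)
    \<le> prod_list (map (\<lambda>(u, w). (\<integral>\<^sup>+x. u x \<partial>M) \<up> (w / W)) xs)"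
  using assms
proof (induction xs arbitrary: W)
  case (Cons p xs)
  obtain u w where p: "p = (u, w)" by force
  define W' where "W' = sum_list (map snd xs)"
  have [measurable]: "u \<in> borel_measurable M" and w: "0 \<le> w" using Cons.prems(1) p by auto
  have nn: "\<forall>y\<in>set (map snd xs). 0 \<le> y" using Cons.prems(1) by fastforce
  have W'0: "0 \<le> W'" unfolding W'_def using nn by (intro sum_list_nonneg) auto
  have W: "W = w + W'" using Cons.prems(2) p W'_def by simp
  show ?case
  proof (cases "W' = 0")
    case True
    then have z: "\<And>v y. (v, y) \<in> set xs \<Longrightarrow> y = 0"
      using nn sum_list_nonneg_eq_0_iff[of "map snd xs"] W'_def by fastforce
    have one: "map (\<lambda>(u, w). f u \<up> (w / W)) xs = map (\<lambda>_. 1) xs" for f :: "('a \<Rightarrow> ennreal) \<Rightarrow> ennreal"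
      by (rule map_cong) (auto dest!: z)
    show ?thesis using True W Cons.prems(3) p one[of "\<lambda>u. u x" for x] one[of "\<lambda>u. (\<integral>\<^sup>+x. u x \<partial>M)"]
      by (simp add: map_replicate_const)
  next
    case False
    then have W'p: "0 < W'" using W'0 by simp
    define v where "v = (\<lambda>x. prod_list (map (\<lambda>(u, w). u x \<up> (w / W')) xs))"
    have [measurable]: "v \<in> borel_measurable M"
      unfolding v_def using Cons.prems(1) by (intro prod_list_rpow_measurable) auto
    have eW: "1 - w / W = W' / W" using W Cons.prems(3) by (simp add: field_simps)
    have e: "prod_list (map (\<lambda>(u, w). f u \<up> (w / W')) xs) \<up> (1 - w / W)
       = prod_list (map (\<lambda>(u, w). f u \<up> (w / W)) xs)" for f :: "('a \<Rightarrow> ennreal) \<Rightarrow> ennreal"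
      unfolding prod_list_rpow eW using W'p by simp
    have "(\<integral>\<^sup>+x. prod_list (map (\<lambda>(u, w). u x \<up> (w / W)) (p # xs)) \<partial>M)
       = (\<integral>\<^sup>+x. u x \<up> (w / W) * v x \<up> (1 - w / W) \<partial>M)"
      unfolding v_def e p by simp
    also have "\<dots> \<le> (\<integral>\<^sup>+x. u x \<partial>M) \<up> (w / W) * (\<integral>\<^sup>+x. v x \<partial>M) \<up> (1 - w / W)"
      using W W'0 w Cons.prems(3) by (intro Hoelder_weighted) auto
    also have "\<dots> \<le> (\<integral>\<^sup>+x. u x \<partial>M) \<up> (w / W)
        * prod_list (map (\<lambda>(u, w). (\<integral>\<^sup>+x. u x \<partial>M) \<up> (w / W')) xs) \<up> (1 - w / W)"
      unfolding v_def using Cons.prems W W'0 W'p w W'_def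
      by (intro mult_left_mono rpow_mono Cons.IH) auto
    finally show ?thesis unfolding e p by simp
  qed
qed simp

lemma Hoelder_list:
  assumes "\<And>u w. (u, w) \<in> set xs \<Longrightarrow> u \<in> borel_measurable M \<and> 0 \<le> w"
    and "sum_list (map snd xs) = 1"
  shows "(\<integral>\<^sup>+x. prod_list (map (\<lambda>(u, w). u x \<up> w) xs) \<partial>M)
    \<le> prod_list (map (\<lambda>(u, w). (\<integral>\<^sup>+x. u x \<partial>M) \<up> w) xs)"
  using Hoelder_list_scaled[OF assms, simplified] by simp

section \<open>Suprema on a line\<close>

lemma abs_le_add_nn_integral_deriv:
  fixes w :: "real \<Rightarrow> real"
  assumes w: "\<And>x. (w has_real_derivative w' x) (at x)" and w': "continuous_on UNIV w'"
  shows "ennreal \<bar>w x\<bar> \<le> ennreal \<bar>w y\<bar> + (\<integral>\<^sup>+z. ennreal \<bar>w' z\<bar> \<partial>lborel)"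
proof -
  define a b where "a = min x y" and "b = max x y"
  have "isCont w' z" for z using w' by (simp add: continuous_on_eq_continuous_at)
  then have I: "has_bochner_integral lborel (\<lambda>z. w' z * indicator {a..b} z) (w b - w a)"
    using w by (intro has_bochner_integral_FTC_Icc_real) (auto simp: a_def b_def)
  have "ennreal \<bar>w x\<bar> \<le> ennreal (\<bar>w y\<bar> + \<bar>w b - w a\<bar>)"
    by (rule ennreal_leI) (auto simp: a_def b_def min_def max_def)
  also have "\<dots> = ennreal \<bar>w y\<bar> + ennreal \<bar>w b - w a\<bar>" by simp
  also have "ennreal \<bar>w b - w a\<bar> \<le> (\<integral>\<^sup>+z. ennreal (norm (w' z * indicator {a..b} z)) \<partial>lborel)"
    using integral_norm_bound_ennreal[of lborel "\<lambda>z. w' z * indicator {a..b} z"] I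
    by (auto simp: has_bochner_integral_iff)
  also have "\<dots> \<le> (\<integral>\<^sup>+z. ennreal \<bar>w' z\<bar> \<partial>lborel)"
    by (intro nn_integral_mono ennreal_leI) (auto simp: indicator_def)
  finally show ?thesis by (simp add: add_left_mono)
qed

lemma sgn_abs_powr_tendsto_0:
  fixes q :: real
  assumes "0 < q"
  shows "((\<lambda>z. sgn z * \<bar>z\<bar> powr q) \<longlongrightarrow> 0) (at 0)"
proof (rule tendsto_norm_zero_cancel)
  have "((\<lambda>z::real. \<bar>z\<bar> powr q) \<longlongrightarrow> 0) (at 0)"
    by (rule tendsto_zero_powrI[where b = q]) (use assms in \<open>auto intro!: tendsto_eq_intros\<close>)
  moreover have "norm (sgn z * \<bar>z\<bar> powr q) = \<bar>z\<bar> powr q" for z :: real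
    by (auto simp: abs_mult sgn_if)
  ultimately show "((\<lambda>z. norm (sgn z * \<bar>z\<bar> powr q)) \<longlongrightarrow> 0) (at 0)" by simp
qed

lemma continuous_sgn_abs_powr:
  fixes q :: real
  assumes "0 < q"
  shows "continuous_on UNIV (\<lambda>z. sgn z * \<bar>z\<bar> powr q)"
proof -
  have "isCont (\<lambda>z. sgn z * \<bar>z\<bar> powr q) x" for x
  proof (cases "x = 0")
    case True
    then show ?thesis using sgn_abs_powr_tendsto_0[OF assms] by (simp add: isCont_def)
  next
    case False
    then show ?thesis by (intro continuous_intros) auto
  qed
  then show ?thesis by (simp add: continuous_on_eq_continuous_at)
qed

lemma has_real_derivative_abs_powr:
  fixes p :: real
  assumes "1 < p"
  shows "((\<lambda>z. \<bar>z\<bar> powr p) has_real_derivative p * (sgn z * \<bar>z\<bar> powr (p - 1))) (at z)"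
proof (cases "z = 0")
  case True
  have "\<forall>\<^sub>F h in at 0. sgn h * \<bar>h\<bar> powr (p - 1) = (\<bar>0 + h\<bar> powr p - \<bar>0\<bar> powr p) / (h::real)"
    unfolding eventually_at_filter
    by (rule always_eventually) (auto simp: powr_diff sgn_if)
  from Lim_transform_eventually[OF sgn_abs_powr_tendsto_0 this] assms
  show ?thesis using True by (simp add: DERIV_def)
next
  case False
  have "(abs has_real_derivative sgn z) (at z)"
  proof (cases "0 < z")
    case True
    then have "(abs has_real_derivative 1) (at z) \<longleftrightarrow> ((\<lambda>x. x) has_real_derivative 1) (at z)"
      by (intro DERIV_cong_ev) (auto
          intro: eventually_mono[OF eventually_nhds_in_open[of "{0<..}" z]])
    then show ?thesis using True by simp
  next
    case False
    then have "z < 0" using \<open>z \<noteq> 0\<close> by simp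
    then have "(abs has_real_derivative - 1) (at z) \<longleftrightarrow> ((\<lambda>x. - x) has_real_derivative - 1) (at z)"
      by (intro DERIV_cong_ev) (auto
          intro: eventually_mono[OF eventually_nhds_in_open[of "{..<0}" z]])
    then show ?thesis using \<open>z < 0\<close> by (auto intro!: derivative_eq_intros)
  qed
  from DERIV_chain2[where f = "\<lambda>y. y powr p" and g = abs, OF has_real_derivative_powr this] False
  show ?thesis by (simp add: ac_simps)
qed

text \<open>The bound by the integral of the derivative of \<open>\<bar>u\<bar>\<^sup>p\<close>, which is continuously differentiable for
  \<open>p > 1\<close>. As \<open>u\<close> takes arbitrarily small values, the boundary term can be made
  arbitrarily small, wherever these values are taken.\<close>

lemma abs_powr_le_nn_integral:
  fixes u :: "real \<Rightarrow> real"
  assumes u: "\<And>x. (u has_real_derivative u' x) (at x)" and u': "continuous_on UNIV u'"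
    and small: "\<And>e. 0 < e \<Longrightarrow> \<exists>y. \<bar>u y\<bar> < e" and p: "1 \<le> p"
  shows "ennreal \<bar>u x\<bar> \<up> p \<le> ennreal p * (\<integral>\<^sup>+z. ennreal \<bar>u z\<bar> \<up> (p - 1) * ennreal \<bar>u' z\<bar> \<partial>lborel)"
proof (cases "p = 1")
  case True
  have "ennreal \<bar>u x\<bar> \<le> (\<integral>\<^sup>+z. ennreal \<bar>u' z\<bar> \<partial>lborel)"
  proof (rule ennreal_le_epsilon)
    fix e :: real assume "0 < e"
    then obtain y where "\<bar>u y\<bar> < e" using small by blast
    then have "ennreal \<bar>u y\<bar> \<le> ennreal e" by (intro ennreal_leI) simp
    from order_trans[OF abs_le_add_nn_integral_deriv[OF u u', of x y] add_right_mono[OF this]]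
    show "ennreal \<bar>u x\<bar> \<le> (\<integral>\<^sup>+z. ennreal \<bar>u' z\<bar> \<partial>lborel) + ennreal e" by (simp only: ac_simps)
  qed
  then show ?thesis using True by simp
next
  case False
  then have p: "1 < p" using p by simp
  define w where "w = (\<lambda>z. \<bar>u z\<bar> powr p)"
  define w' where "w' = (\<lambda>z. p * (sgn (u z) * \<bar>u z\<bar> powr (p - 1)) * u' z)"
  have cu: "continuous_on UNIV u" using u by (meson DERIV_continuous_on has_field_derivative_at_within)
  have dw: "(w has_real_derivative w' z) (at z)" for z
    unfolding w_def w'_def by (rule DERIV_chain2[OF has_real_derivative_abs_powr[OF p] u])
  have cw: "continuous_on UNIV w'"
    unfolding w'_def
    by (intro continuous_intros u' continuous_on_compose2[OF continuous_sgn_abs_powr cu]) (use p in auto)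
  have [measurable]: "u \<in> borel_measurable borel" "u' \<in> borel_measurable borel"
    using cu u' by (auto intro: borel_measurable_continuous_onI)
  have "ennreal \<bar>w x\<bar> \<le> (\<integral>\<^sup>+z. ennreal \<bar>w' z\<bar> \<partial>lborel)"
  proof (rule ennreal_le_epsilon)
    fix e :: real assume e: "0 < e"
    then obtain y where "\<bar>u y\<bar> < e powr (1 / p)" using small[of "e powr (1 / p)"] by auto
    then have "w y \<le> (e powr (1 / p)) powr p" unfolding w_def using p by (intro powr_mono2) auto
    then have "ennreal \<bar>w y\<bar> \<le> ennreal e" using e p by (intro ennreal_leI) (simp add: powr_powr w_def)
    from order_trans[OF abs_le_add_nn_integral_deriv[OF dw cw, of x y] add_right_mono[OF this]]
    show "ennreal \<bar>w x\<bar> \<le> (\<integral>\<^sup>+z. ennreal \<bar>w' z\<bar> \<partial>lborel) + ennreal e" by (simp only: ac_simps)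
  qed
  also have "\<dots> = (\<integral>\<^sup>+z. ennreal p * (ennreal \<bar>u z\<bar> \<up> (p - 1) * ennreal \<bar>u' z\<bar>) \<partial>lborel)"
    using p by (intro nn_integral_cong) (auto simp: w'_def ennreal_rpow ennreal_mult[symmetric] abs_mult sgn_if)
  also have "\<dots> = ennreal p * (\<integral>\<^sup>+z. ennreal \<bar>u z\<bar> \<up> (p - 1) * ennreal \<bar>u' z\<bar> \<partial>lborel)"
    by (rule nn_integral_cmult) measurable
  finally show ?thesis using p by (simp add: w_def ennreal_rpow)
qed

lemma small_values_of_finite_integral:
  fixes u :: "real \<Rightarrow> real"
  assumes "(\<integral>\<^sup>+z. ennreal \<bar>u z\<bar> \<up> s \<partial>lborel) < \<infinity>" "0 < s" "0 < e"
  shows "\<exists>y. \<bar>u y\<bar> < e"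
proof (rule ccontr)
  assume "\<nexists>y. \<bar>u y\<bar> < e"
  then have "ennreal (e powr s) \<le> ennreal \<bar>u z\<bar> \<up> s" for z
    using assms by (auto simp: ennreal_rpow not_less intro!: ennreal_leI powr_mono2)
  then have "(\<integral>\<^sup>+z. ennreal (e powr s) \<partial>(lborel :: real measure)) \<le> (\<integral>\<^sup>+z. ennreal \<bar>u z\<bar> \<up> s \<partial>lborel)"
    by (intro nn_integral_mono) auto
  then show False using assms by (simp add: ennreal_mult_top)
qed

lemma small_values_of_tendsto_0:
  fixes u :: "real \<Rightarrow> real"
  assumes "(u \<longlongrightarrow> 0) at_infinity" "0 < e"
  shows "\<exists>y. \<bar>u y\<bar> < e"
proof -
  have "\<forall>\<^sub>F x in at_infinity. \<bar>u x\<bar> < e" using tendstoD[OF assms] by simp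
  then obtain b where "\<forall>x. b \<le> norm x \<longrightarrow> \<bar>u x\<bar> < e" unfolding eventually_at_infinity by blast
  then show ?thesis by (intro exI[of _ "\<bar>b\<bar>"]) auto
qed

text \<open>A way to use \<open>L\<^sup>p\<close> norms in Hoelder's inequality with weights without distinguishing \<open>p = \<infinity>\<close>: for
  finite \<open>p\<close> take \<open>U = u\<^sup>p\<close> and \<open>k = 1\<close>; for \<open>p = \<infinity>\<close> the weight \<open>w\<close> is \<open>0\<close>, and \<open>k\<close> is the
  essential supremum.\<close>

lemma Lnorm_majorant:
  assumes [measurable]: "u \<in> borel_measurable M" and "1 \<le> p" "1 / p = ennreal w" "0 \<le> w"
  obtains U k where "U \<in> borel_measurable M" "AE x in M. u x \<le> k * U x \<up> w"
    "k * (\<integral>\<^sup>+x. U x \<partial>M) \<up> w \<le> Lnorm M p u"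
proof (cases "p = \<infinity>")
  case True
  then have "w = 0" using assms by (simp add: ennreal_eq_0_iff)
  then show ?thesis
    using that[of "\<lambda>_. 0" "esssup M u"] True esssup_AE[of u M] by (auto simp: Lnorm_def)
next
  case False
  then obtain p' where p': "p = ennreal p'" "1 \<le> p'" using assms(2)
    by (cases p) (auto simp: top_unique)
  have "1 / p = ennreal (1 / p')" using p' by (simp add: divide_ennreal[symmetric])
  then have w: "w = 1 / p'" using assms p' by simp
  have "Lnorm M p u = (\<integral>\<^sup>+x. u x \<up> p' \<partial>M) \<up> w"
    unfolding Lnorm_def using False p' assms(3,4) by (simp add: epow_eq_rpow)
  then show ?thesis
    using that[of "\<lambda>x. u x \<up> p'" 1] w p' by (auto simp: rpow_rpow)
qed

lemma AE_le_imp_le_continuous: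
  fixes u :: "real \<Rightarrow> real"
  assumes "continuous_on UNIV u" "AE x in lborel. ennreal \<bar>u x\<bar> \<le> c"
  shows "ennreal \<bar>u x\<bar> \<le> c"
proof (rule ccontr)
  define S where "S = {x. c < ennreal \<bar>u x\<bar>}"
  assume "\<not> ?thesis"
  then have ne: "S \<noteq> {}" by (auto simp: S_def not_le)
  have op: "open S"
    unfolding S_def using assms(1) by (intro open_Collect_less continuous_intros continuous_on_ennreal) auto
  then have "S \<in> null_sets lborel"
    using assms(2) AE_iff_null_sets[of S lborel] by (auto simp: S_def not_less)
  then have "negligible S" by (simp add: negligible_iff_null_sets null_sets_completionI)
  then show False using open_not_negligible[OF op ne] by simp
qed

lemma abs_le_Lnorm_infinity:
  fixes u :: "real \<Rightarrow> real"
  assumes "continuous_on UNIV u"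
  shows "ennreal \<bar>u x\<bar> \<le> Lnorm lborel \<infinity> (\<lambda>x. ennreal \<bar>u x\<bar>)"
  using AE_le_imp_le_continuous[OF assms esssup_AE] by (simp add: Lnorm_def)

text \<open>This lemma and \<open>ennreal_one_divide_gt_2\<close> below replace an exponent by its reciprocal, a real number
  which is \<open>0\<close> for the exponent \<open>\<infinity>\<close>.\<close>

lemma ennreal_one_divide:
  assumes "1 \<le> p" obtains w where "1 / p = ennreal w" "0 \<le> w" "w \<le> 1"
    "quot_minus p 1 = ennreal (1 - w)" "w = 0 \<longleftrightarrow> p = \<infinity>" "w = 1 \<longleftrightarrow> p = 1"
    "p \<noteq> \<infinity> \<Longrightarrow> p = ennreal (1 / w)"
proof (cases "p = \<infinity>")
  case True
  then show ?thesis using that[of 0] by (auto simp: quot_minus_def)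
next
  case False
  then obtain p' where p': "p = ennreal p'" "1 \<le> p'" using assms
    by (cases p) (auto simp: top_unique)
  have "p - 1 = ennreal (p' - 1)" using p' by (simp add: ennreal_minus[symmetric])
  then have "quot_minus p 1 = ennreal (1 - 1 / p')"
    using p' by (simp add: quot_minus_def divide_ennreal diff_divide_distrib)
  moreover have "1 / p = ennreal (1 / p')" using p' by (simp add: divide_ennreal[symmetric])
  ultimately show ?thesis using that[of "1 / p'"] p' by auto
qed

text \<open>In the main case \<open>0 < \<mu> < 1\<close>, \<open>\<alpha> > 1\<close>, \<open>s < \<infinity>\<close>, the power \<open>p = 1 / \<mu>\<close> is chosen so that
  \<open>p - 1 = s \<kappa>\<close>, where \<open>\<kappa> = 1 - 1 / \<alpha>\<close>: then Hoelder bounds \<open>\<integral> \<bar>u\<bar>\<^bsup>p - 1\<^esup> \<bar>u'\<bar>\<close> by the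
  \<open>L\<^sup>\<alpha>\<close> norm of \<open>u'\<close> and the power \<open>p - 1\<close> of the \<open>L\<^sup>s\<close> norm of \<open>u\<close>. In the other cases
  \<open>\<bar>u\<bar>\<close> is bounded by the \<open>L\<^sup>1\<close> norm of \<open>u'\<close>, by the \<open>L\<^sup>\<infinity>\<close> norm of \<open>u\<close>, or by both, and
  \<open>\<bar>u\<bar> = \<bar>u\<bar>\<^sup>\<mu> \<bar>u\<bar>\<^bsup>1 - \<mu>\<^esup>\<close>.\<close>

lemma sup_interpolation:
  fixes u :: "real \<Rightarrow> real"
  assumes u: "\<And>x. (u has_real_derivative u' x) (at x)" and u': "continuous_on UNIV u'"
    and \<alpha>: "1 \<le> \<alpha>" "1 / \<alpha> = ennreal (1 - \<kappa>)" "0 \<le> \<kappa>" "\<kappa> \<le> 1" "\<kappa> = 0 \<longleftrightarrow> \<alpha> = 1"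
    and s: "1 \<le> s" "1 / s = ennreal \<sigma>" "0 \<le> \<sigma>" "\<sigma> = 0 \<longleftrightarrow> s = \<infinity>" "s \<noteq> \<infinity> \<Longrightarrow> s = ennreal (1 / \<sigma>)"
    and \<mu>: "0 \<le> \<mu>" "\<mu> \<le> 1" "\<mu> * \<kappa> = (1 - \<mu>) * \<sigma>"
    and lim: "\<alpha> = 1 \<Longrightarrow> (u \<longlongrightarrow> 0) at_infinity"
    and fin: "\<mu> < 1 \<Longrightarrow> Lnorm lborel s (\<lambda>x. ennreal \<bar>u x\<bar>) < \<infinity>"
  shows "ennreal \<bar>u x\<bar> \<le> ennreal (max 1 (1 / \<mu>)) *
    (Lnorm lborel \<alpha> (\<lambda>x. ennreal \<bar>u' x\<bar>) \<up> \<mu> * Lnorm lborel s (\<lambda>x. ennreal \<bar>u x\<bar>) \<up> (1 - \<mu>))"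
    (is "?M \<le> ennreal ?C * (?A \<up> \<mu> * ?S \<up> (1 - \<mu>))")
proof -
  have cu: "continuous_on UNIV u" using u by (meson DERIV_continuous_on has_field_derivative_at_within)
  have [measurable]: "u \<in> borel_measurable borel" "u' \<in> borel_measurable borel"
    using cu u' by (auto intro: borel_measurable_continuous_onI)
  have C: "1 \<le> ennreal ?C" by simp
  have *: ?thesis if "?M \<le> ?A \<or> \<mu> = 0" "?M \<le> ?S \<or> \<mu> = 1"
  proof -
    have "?M = ?M \<up> \<mu> * ?M \<up> (1 - \<mu>)" using \<mu> by (simp add: rpow_add')
    also have "?M \<up> \<mu> \<le> ?A \<up> \<mu>" using that \<mu> by (cases "\<mu> = 0") (auto intro: rpow_mono)
    also have "?M \<up> (1 - \<mu>) \<le> ?S \<up> (1 - \<mu>)" using that \<mu> by (cases "\<mu> = 1") (auto intro: rpow_mono)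
    finally have "?M \<le> ?A \<up> \<mu> * ?S \<up> (1 - \<mu>)" by (simp add: mult_left_mono mult_right_mono)
    then show ?thesis using mult_mono[OF C, of ?M] by simp
  qed
  have S: "?M \<le> ?S" if "s = \<infinity>" using abs_le_Lnorm_infinity[OF cu] that by simp
  consider "\<kappa> = 0" | "\<mu> = 0" | "0 < \<kappa>" "0 < \<mu>" using \<alpha> \<mu> by fastforce
  then show ?thesis
  proof cases
    case 1
    then have "\<alpha> = 1" "\<mu> = 1 \<or> s = \<infinity>" using \<alpha> \<mu> s by auto
    moreover have "?M \<le> ?A"
      using abs_powr_le_nn_integral[OF u u' small_values_of_tendsto_0[OF lim], of 1 x] \<open>\<alpha> = 1\<close>
      by (simp add: Lnorm_def epow_eq_rpow[of 1, simplified])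
    ultimately show ?thesis using * S by blast
  next
    case 2
    then have "s = \<infinity>" using \<mu> s by auto
    then show ?thesis using * S 2 by auto
  next
    case 3
    then have "(1 - \<mu>) * \<sigma> \<noteq> 0" using \<mu> by (metis mult_pos_pos less_irrefl)
    then have m: "\<mu> < 1" and \<sigma>: "0 < \<sigma>" using \<mu> s by auto
    then have s': "s = ennreal (1 / \<sigma>)" "s \<noteq> \<infinity>" using s by auto
    define I where "I = (\<integral>\<^sup>+z. ennreal \<bar>u z\<bar> \<up> (1 / \<sigma>) \<partial>lborel)"
    have SI: "?S = I \<up> \<sigma>"
      unfolding Lnorm_def I_def using s' s(2) \<sigma> by (simp add: epow_eq_rpow)
    then have "I < \<infinity>" using fin[OF m] \<sigma> by (simp add: rpow_less_top_iff)
    then have small: "\<exists>y. \<bar>u y\<bar> < e" if "0 < e" for e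
      using small_values_of_finite_integral[of u "1 / \<sigma>"] \<sigma> that by (simp add: I_def)
    obtain U k where [measurable]: "U \<in> borel_measurable lborel"
      and U: "AE x in lborel. ennreal \<bar>u' x\<bar> \<le> k * U x \<up> (1 - \<kappa>)"
      and k: "k * (\<integral>\<^sup>+x. U x \<partial>lborel) \<up> (1 - \<kappa>) \<le> ?A"
      using Lnorm_majorant[of "\<lambda>x. ennreal \<bar>u' x\<bar>" lborel \<alpha> "1 - \<kappa>"] \<alpha> by auto
    \<comment> \<open>Here \<open>\<sigma> = 1 / s\<close>; this is \<open>p - 1 = s \<kappa>\<close>.\<close>
    have e: "1 / \<mu> - 1 = 1 / \<sigma> * \<kappa>" using \<mu>(3) 3 \<sigma> by (simp add: field_simps)
    have "?M \<up> (1 / \<mu>) \<le> ennreal (1 / \<mu>) * (\<integral>\<^sup>+z. ennreal \<bar>u z\<bar> \<up> (1 / \<mu> - 1) * ennreal \<bar>u' z\<bar> \<partial>lborel)"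
      using m 3 by (intro abs_powr_le_nn_integral[OF u u' small]) auto
    also have "(\<integral>\<^sup>+z. ennreal \<bar>u z\<bar> \<up> (1 / \<mu> - 1) * ennreal \<bar>u' z\<bar> \<partial>lborel)
        \<le> (\<integral>\<^sup>+z. k * ((ennreal \<bar>u z\<bar> \<up> (1 / \<sigma>)) \<up> \<kappa> * U z \<up> (1 - \<kappa>)) \<partial>lborel)"
    proof (intro nn_integral_mono_AE, use U in eventually_elim)
      fix z assume "ennreal \<bar>u' z\<bar> \<le> k * U z \<up> (1 - \<kappa>)"
      then have "ennreal \<bar>u z\<bar> \<up> (1 / \<sigma> * \<kappa>) * ennreal \<bar>u' z\<bar>
          \<le> ennreal \<bar>u z\<bar> \<up> (1 / \<sigma> * \<kappa>) * (k * U z \<up> (1 - \<kappa>))"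
        by (rule mult_left_mono) simp
      then show "ennreal \<bar>u z\<bar> \<up> (1 / \<mu> - 1) * ennreal \<bar>u' z\<bar>
          \<le> k * ((ennreal \<bar>u z\<bar> \<up> (1 / \<sigma>)) \<up> \<kappa> * U z \<up> (1 - \<kappa>))"
        unfolding e rpow_rpow by (simp only: ac_simps)
    qed
    also have "\<dots> = k * (\<integral>\<^sup>+z. (ennreal \<bar>u z\<bar> \<up> (1 / \<sigma>)) \<up> \<kappa> * U z \<up> (1 - \<kappa>) \<partial>lborel)"
      by (rule nn_integral_cmult) measurable
    also have "\<dots> \<le> k * (I \<up> \<kappa> * (\<integral>\<^sup>+z. U z \<partial>lborel) \<up> (1 - \<kappa>))"
      unfolding I_def using \<alpha> by (intro mult_left_mono Hoelder_weighted) auto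
    also have "\<dots> = (k * (\<integral>\<^sup>+z. U z \<partial>lborel) \<up> (1 - \<kappa>)) * I \<up> \<kappa>" by (simp add: ac_simps)
    also have "\<dots> \<le> ?A * I \<up> \<kappa>" using k by (rule mult_right_mono) simp
    finally have "?M \<up> (1 / \<mu>) \<le> ennreal (1 / \<mu>) * (?A * I \<up> \<kappa>)" by (simp add: mult_left_mono)
    then have "(?M \<up> (1 / \<mu>)) \<up> \<mu> \<le> (ennreal (1 / \<mu>) * (?A * I \<up> \<kappa>)) \<up> \<mu>" by (rule rpow_mono) (use 3 in auto)
    then have "?M \<le> ennreal (1 / \<mu>) \<up> \<mu> * (?A \<up> \<mu> * ?S \<up> (1 - \<mu>))"
      using 3 \<mu>(3) by (simp add: rpow_rpow rpow_mult SI ac_simps)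
    \<comment> \<open>The power \<open>\<mu>\<close> of \<open>p = 1 / \<mu>\<close> is at most \<open>p\<close>; the maximum with \<open>1\<close> in the constant serves the cases
      with constant \<open>1\<close>, among them \<open>\<mu> = 0\<close>, where \<open>1 / \<mu>\<close> is \<open>0\<close>.\<close>
    also have "ennreal (1 / \<mu>) \<up> \<mu> \<le> ennreal ?C"
      using 3 m powr_mono[of \<mu> 1 "1 / \<mu>"] by (auto simp: ennreal_rpow intro!: ennreal_leI)
    finally show ?thesis by (simp add: mult_right_mono)
  qed
qed

section \<open>An anisotropic Ladyzhenskaya inequality in the plane\<close>

lemma nn_integral_lborel_prod:
  fixes f :: "'a::euclidean_space \<times> 'b::euclidean_space \<Rightarrow> ennreal"
  assumes [measurable]: "f \<in> borel_measurable borel"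
  shows "(\<integral>\<^sup>+z. f z \<partial>lborel) = (\<integral>\<^sup>+x. \<integral>\<^sup>+y. f (x, y) \<partial>lborel \<partial>lborel)"
    and "(\<integral>\<^sup>+z. f z \<partial>lborel) = (\<integral>\<^sup>+y. \<integral>\<^sup>+x. f (x, y) \<partial>lborel \<partial>lborel)"
proof -
  have f: "f \<in> borel_measurable (lborel \<Otimes>\<^sub>M lborel)" by (simp add: lborel_prod)
  show "(\<integral>\<^sup>+z. f z \<partial>lborel) = (\<integral>\<^sup>+x. \<integral>\<^sup>+y. f (x, y) \<partial>lborel \<partial>lborel)"
    using lborel.nn_integral_fst[OF f] by (simp add: lborel_prod)
  show "(\<integral>\<^sup>+z. f z \<partial>lborel) = (\<integral>\<^sup>+y. \<integral>\<^sup>+x. f (x, y) \<partial>lborel \<partial>lborel)"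
    using lborel_pair.nn_integral_snd[OF f] by (simp add: lborel_prod)
qed

lemma nn_integral_lborel_prod_measurable:
  fixes f :: "'a::euclidean_space \<times> 'b::euclidean_space \<Rightarrow> ennreal"
  assumes "f \<in> borel_measurable borel"
  shows "(\<lambda>x. \<integral>\<^sup>+y. f (x, y) \<partial>lborel) \<in> borel_measurable borel"
  using lborel.borel_measurable_nn_integral_fst[of f lborel] assms by (simp add: lborel_prod)

definition planar_C1 :: "(real \<times> real \<Rightarrow> real) \<Rightarrow> (real \<times> real \<Rightarrow> real) \<Rightarrow> (real \<times> real \<Rightarrow> real) \<Rightarrow> bool" where
  "planar_C1 h h1 h2 \<longleftrightarrow> continuous_on UNIV h \<and> continuous_on UNIV h1 \<and> continuous_on UNIV h2
     \<and> (\<forall>x y. ((\<lambda>x. h (x, y)) has_real_derivative h1 (x, y)) (at x))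
     \<and> (\<forall>x y. ((\<lambda>y. h (x, y)) has_real_derivative h2 (x, y)) (at y))"

definition power_integral :: "real \<Rightarrow> (real \<times> real \<Rightarrow> real) \<Rightarrow> ennreal" where
  "power_integral p h = (\<integral>\<^sup>+z. ennreal \<bar>h z\<bar> \<up> p \<partial>lborel)"

lemma continuous_on_slice:
  assumes "continuous_on UNIV h"
  shows "continuous_on UNIV (\<lambda>x. h (x, y))" "continuous_on UNIV (\<lambda>y. h (x, y))"
  by (intro continuous_on_compose2[OF assms] continuous_intros; simp)+

lemma Cauchy_Schwarz_power:
  assumes [measurable]: "h \<in> borel_measurable borel" "h1 \<in> borel_measurable borel" and "0 < m"
  shows "(\<integral>\<^sup>+z. ennreal \<bar>h z\<bar> \<up> m * ennreal \<bar>h1 z\<bar> \<partial>lborel)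
    \<le> power_integral (2 * m) h \<up> (1 / 2) * power_integral 2 h1 \<up> (1 / 2)"
  using Hoelder_weighted[of "\<lambda>z. ennreal \<bar>h z\<bar> \<up> (2 * m)" lborel "\<lambda>z. ennreal \<bar>h1 z\<bar> \<up> 2" "1 / 2"]
  by (simp add: rpow_rpow power_integral_def)

text \<open>Almost every line parallel to an axis carries finite \<open>\<integral> h\<^sup>2\<close>, so \<open>h\<close> takes arbitrarily small values on it, and \<open>\<bar>h(x, y)\<bar>\<^bsup>m + 1\<^esup>\<close> is bounded
  almost everywhere both by a function of \<open>x\<close> and by a function of \<open>y\<close>. The integral of the product of these two bounds
  is the product of their integrals, and Cauchy-Schwarz bounds each of these.\<close>

lemma planar_power_step:
  assumes h: "planar_C1 h h1 h2" and fin: "power_integral 2 h < \<infinity>" and m: "1 \<le> m"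
  shows "power_integral (2 * (m + 1)) h \<le> ennreal ((m + 1)\<^sup>2) *
    (power_integral (2 * m) h * (power_integral 2 h1 \<up> (1 / 2) * power_integral 2 h2 \<up> (1 / 2)))"
proof -
  have c: "continuous_on UNIV h" "continuous_on UNIV h1" "continuous_on UNIV h2"
    using h by (auto simp: planar_C1_def)
  have [measurable]: "h \<in> borel_measurable borel" "h1 \<in> borel_measurable borel" "h2 \<in> borel_measurable borel"
    using c by (auto intro: borel_measurable_continuous_onI)
  have m': "(\<lambda>z. ennreal \<bar>h z\<bar> \<up> p) \<in> borel_measurable borel" for p by measurable
  define A where "A = (\<lambda>y. \<integral>\<^sup>+x. ennreal \<bar>h (x, y)\<bar> \<up> m * ennreal \<bar>h1 (x, y)\<bar> \<partial>lborel)"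
  define B where "B = (\<lambda>x. \<integral>\<^sup>+y. ennreal \<bar>h (x, y)\<bar> \<up> m * ennreal \<bar>h2 (x, y)\<bar> \<partial>lborel)"
  have [measurable]: "A \<in> borel_measurable borel" "B \<in> borel_measurable borel"
    unfolding A_def B_def borel_prod[symmetric] by measurable
  have "AE y in lborel. (\<integral>\<^sup>+x. ennreal \<bar>h (x, y)\<bar> \<up> 2 \<partial>lborel) \<noteq> \<infinity>"
    using fin unfolding power_integral_def nn_integral_lborel_prod(2)[OF m']
    by (intro nn_integral_noteq_infinite) (auto simp: borel_prod[symmetric])
  then have Ay: "AE y in lborel. \<forall>x. ennreal \<bar>h (x, y)\<bar> \<up> (m + 1) \<le> ennreal (m + 1) * A y"
  proof eventually_elim
    case (elim y)
    then have s: "\<exists>x. \<bar>h (x, y)\<bar> < e" if "0 < e" for e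
      using that by (intro small_values_of_finite_integral[where s = 2]) (auto simp: less_top)
    show ?case
      using abs_powr_le_nn_integral[of "\<lambda>x. h (x, y)" "\<lambda>x. h1 (x, y)" "m + 1"]
        h continuous_on_slice(1)[OF c(2)] s m by (simp add: A_def planar_C1_def)
  qed
  have "AE x in lborel. (\<integral>\<^sup>+y. ennreal \<bar>h (x, y)\<bar> \<up> 2 \<partial>lborel) \<noteq> \<infinity>"
    using fin unfolding power_integral_def nn_integral_lborel_prod(1)[OF m']
    by (intro nn_integral_noteq_infinite) (auto simp: borel_prod[symmetric])
  then have Bx: "AE x in lborel. \<forall>y. ennreal \<bar>h (x, y)\<bar> \<up> (m + 1) \<le> ennreal (m + 1) * B x"
  proof eventually_elim
    case (elim x)
    then have s: "\<exists>y. \<bar>h (x, y)\<bar> < e" if "0 < e" for e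
      using that by (intro small_values_of_finite_integral[where s = 2]) (auto simp: less_top)
    show ?case
      using abs_powr_le_nn_integral[of "\<lambda>y. h (x, y)" "\<lambda>y. h2 (x, y)" "m + 1"]
        h continuous_on_slice(2)[OF c(3)] s m by (simp add: B_def planar_C1_def)
  qed
  have "power_integral (2 * (m + 1)) h = (\<integral>\<^sup>+x. \<integral>\<^sup>+y. ennreal \<bar>h (x, y)\<bar> \<up> (2 * (m + 1)) \<partial>lborel \<partial>lborel)"
    unfolding power_integral_def by (rule nn_integral_lborel_prod(1)[OF m'])
  also have "\<dots> \<le> (\<integral>\<^sup>+x. \<integral>\<^sup>+y. (ennreal (m + 1) * B x) * (ennreal (m + 1) * A y) \<partial>lborel \<partial>lborel)"
  proof (intro nn_integral_mono_AE, use Bx in eventually_elim, intro nn_integral_mono_AE, use Ay in eventually_elim)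
    fix x y
    assume "\<forall>y. ennreal \<bar>h (x, y)\<bar> \<up> (m + 1) \<le> ennreal (m + 1) * B x"
      and "\<forall>x. ennreal \<bar>h (x, y)\<bar> \<up> (m + 1) \<le> ennreal (m + 1) * A y"
    moreover have "ennreal \<bar>h (x, y)\<bar> \<up> (2 * (m + 1)) = ennreal \<bar>h (x, y)\<bar> \<up> (m + 1) * ennreal \<bar>h (x, y)\<bar> \<up> (m + 1)"
      using m by (intro rpow_add'[symmetric]) auto
    ultimately show "ennreal \<bar>h (x, y)\<bar> \<up> (2 * (m + 1)) \<le> (ennreal (m + 1) * B x) * (ennreal (m + 1) * A y)"
      by (simp add: mult_mono)
  qed
  also have "\<dots> = (ennreal (m + 1) * (\<integral>\<^sup>+x. B x \<partial>lborel)) * (ennreal (m + 1) * (\<integral>\<^sup>+y. A y \<partial>lborel))"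
    by (simp add: nn_integral_cmult nn_integral_multc)
  also have "\<dots> = ennreal ((m + 1)\<^sup>2) * ((\<integral>\<^sup>+y. A y \<partial>lborel) * (\<integral>\<^sup>+x. B x \<partial>lborel))"
    using m by (simp add: power2_eq_square ennreal_mult ac_simps)
  also have "(\<integral>\<^sup>+y. A y \<partial>lborel) = (\<integral>\<^sup>+z. ennreal \<bar>h z\<bar> \<up> m * ennreal \<bar>h1 z\<bar> \<partial>lborel)"
    unfolding A_def by (rule nn_integral_lborel_prod(2)[symmetric]) measurable
  also have "(\<integral>\<^sup>+x. B x \<partial>lborel) = (\<integral>\<^sup>+z. ennreal \<bar>h z\<bar> \<up> m * ennreal \<bar>h2 z\<bar> \<partial>lborel)"
    unfolding B_def by (rule nn_integral_lborel_prod(1)[symmetric]) measurable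
  also have "ennreal ((m + 1)\<^sup>2) * ((\<integral>\<^sup>+z. ennreal \<bar>h z\<bar> \<up> m * ennreal \<bar>h1 z\<bar> \<partial>lborel)
        * (\<integral>\<^sup>+z. ennreal \<bar>h z\<bar> \<up> m * ennreal \<bar>h2 z\<bar> \<partial>lborel))
      \<le> ennreal ((m + 1)\<^sup>2) * ((power_integral (2 * m) h \<up> (1 / 2) * power_integral 2 h1 \<up> (1 / 2))
        * (power_integral (2 * m) h \<up> (1 / 2) * power_integral 2 h2 \<up> (1 / 2)))"
    using m by (intro mult_left_mono mult_mono Cauchy_Schwarz_power) auto
  also have "\<dots> = ennreal ((m + 1)\<^sup>2) * ((power_integral (2 * m) h \<up> (1 / 2) * power_integral (2 * m) h \<up> (1 / 2))
        * (power_integral 2 h1 \<up> (1 / 2) * power_integral 2 h2 \<up> (1 / 2)))"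
    by (simp only: ac_simps)
  finally show ?thesis by (simp add: rpow_add')
qed

lemma planar_even_power:
  assumes h: "planar_C1 h h1 h2" and fin: "power_integral 2 h < \<infinity>"
  shows "power_integral (2 * (real n + 1)) h \<le> ennreal ((fact (n + 1))\<^sup>2) *
    (power_integral 2 h * (power_integral 2 h1 \<up> (1 / 2) * power_integral 2 h2 \<up> (1 / 2)) \<up> real n)"
proof (induction n)
  case (Suc n)
  let ?K = "power_integral 2 h1 \<up> (1 / 2) * power_integral 2 h2 \<up> (1 / 2)"
  have "power_integral (2 * (real (Suc n) + 1)) h
      \<le> ennreal ((real (Suc n) + 1)\<^sup>2) * (power_integral (2 * (real n + 1)) h * ?K)"
    using planar_power_step[OF h fin, of "real (Suc n)"] by (simp add: ac_simps)
  also have "\<dots> \<le> ennreal ((real (Suc n) + 1)\<^sup>2) *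
      ((ennreal ((fact (n + 1))\<^sup>2) * (power_integral 2 h * ?K \<up> real n)) * ?K)"
    by (intro mult_left_mono mult_right_mono Suc.IH) auto
  also have "\<dots> = (ennreal ((real (Suc n) + 1)\<^sup>2) * ennreal ((fact (n + 1))\<^sup>2)) *
      (power_integral 2 h * (?K \<up> real n * ?K \<up> 1))"
    by (simp add: ac_simps)
  also have "?K \<up> real n * ?K \<up> 1 = ?K \<up> real (Suc n)" by (rule rpow_add') auto
  also have "ennreal ((real (Suc n) + 1)\<^sup>2) * ennreal ((fact (n + 1))\<^sup>2) = ennreal ((fact (Suc n + 1))\<^sup>2)"
    by (simp add: ennreal_mult[symmetric] power_mult_distrib[symmetric] algebra_simps)
  finally show ?case .
qed simp

text \<open>With \<open>q = 1 / (1 - 2 \<rho>)\<close>, the exponent \<open>2 q\<close> lies between \<open>2\<close> and the even integer \<open>2 (n + 1)\<close>;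
  \<open>l\<close> is the corresponding Hoelder weight, \<open>2 q = 2 (n + 1) l + 2 (1 - l)\<close>.\<close>

lemma planar_interpolation:
  assumes \<rho>: "0 \<le> \<rho>" "\<rho> < 1 / 2"
  obtains C :: real where "0 < C" "\<And>h h1 h2. planar_C1 h h1 h2 \<Longrightarrow> power_integral 2 h < \<infinity> \<Longrightarrow>
    power_integral (2 / (1 - 2 * \<rho>)) h \<up> (1 - 2 * \<rho>)
    \<le> ennreal C * (power_integral 2 h \<up> (1 - 2 * \<rho>) * power_integral 2 h1 \<up> \<rho> * power_integral 2 h2 \<up> \<rho>)"
proof (cases "\<rho> = 0")
  case True
  then show ?thesis using that[of 1] by simp
next
  case False
  define q where "q = 1 / (1 - 2 * \<rho>)"
  have q: "1 < q" using \<rho> False by (simp add: q_def field_simps)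
  obtain n where n: "q - 1 \<le> real n" using real_arch_simple by blast
  then have n0: "0 < real n" using q by linarith
  define l where "l = (q - 1) / real n"
  have l: "0 < l" "l \<le> 1" using n n0 q by (auto simp: l_def)
  \<comment> \<open>The gradient factor enters to the power \<open>real n * l * d = 2 * \<rho>\<close>, for every choice of \<open>n\<close>.\<close>
  define d where "d = 1 - 2 * \<rho>"
  have d: "0 < d" "q * d = 1" "2 / (1 - 2 * \<rho>) = 2 * q" "real n * l * d = 2 * \<rho>"
    using \<rho> n0 by (auto simp: d_def q_def l_def field_simps)
  let ?c = "ennreal ((fact (n + 1))\<^sup>2)"
  have "power_integral (2 * q) h \<up> d
    \<le> ennreal (((fact (n + 1))\<^sup>2) powr (l * d)) * (power_integral 2 h \<up> d * power_integral 2 h1 \<up> \<rho> * power_integral 2 h2 \<up> \<rho>)"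
    if h: "planar_C1 h h1 h2" and fin: "power_integral 2 h < \<infinity>" for h h1 h2
  proof -
    have [measurable]: "h \<in> borel_measurable borel"
      using h by (auto simp: planar_C1_def intro: borel_measurable_continuous_onI)
    let ?K = "power_integral 2 h1 \<up> (1 / 2) * power_integral 2 h2 \<up> (1 / 2)"
    have "2 * (real n + 1) * l + 2 * (1 - l) = 2 * q" using n0 by (simp add: l_def field_simps)
    then have "power_integral (2 * q) h
        = (\<integral>\<^sup>+z. (ennreal \<bar>h z\<bar> \<up> (2 * (real n + 1))) \<up> l * (ennreal \<bar>h z\<bar> \<up> 2) \<up> (1 - l) \<partial>lborel)"
      unfolding power_integral_def rpow_rpow using l
      by (intro nn_integral_cong rpow_add'[symmetric]) auto
    also have "\<dots> \<le> power_integral (2 * (real n + 1)) h \<up> l * power_integral 2 h \<up> (1 - l)"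
      unfolding power_integral_def using l by (intro Hoelder_weighted) auto
    also have "\<dots> \<le> (?c * (power_integral 2 h * ?K \<up> real n)) \<up> l * power_integral 2 h \<up> (1 - l)"
      using l by (intro mult_right_mono rpow_mono planar_even_power[OF h fin]) auto
    also have "\<dots> = ?c \<up> l * ((power_integral 2 h \<up> l * power_integral 2 h \<up> (1 - l)) * ?K \<up> (real n * l))"
      by (simp add: rpow_mult rpow_rpow ac_simps)
    also have "power_integral 2 h \<up> l * power_integral 2 h \<up> (1 - l) = power_integral 2 h"
      using l by (simp add: rpow_add')
    finally have "power_integral (2 * q) h \<up> d \<le> (?c \<up> l * (power_integral 2 h * ?K \<up> (real n * l))) \<up> d"
      using d by (intro rpow_mono) auto
    also have "\<dots> = ?c \<up> (l * d) * (power_integral 2 h \<up> d * ?K \<up> (2 * \<rho>))"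
      by (simp add: rpow_mult rpow_rpow d)
    also have "?c \<up> (l * d) = ennreal (((fact (n + 1))\<^sup>2) powr (l * d))"
      using l d by (intro ennreal_rpow) auto
    also have "?K \<up> (2 * \<rho>) = power_integral 2 h1 \<up> \<rho> * power_integral 2 h2 \<up> \<rho>"
      by (simp add: rpow_mult rpow_rpow)
    finally show ?thesis by (simp add: ac_simps)
  qed
  then show ?thesis using that[of "((fact (n + 1))\<^sup>2) powr (l * d)"] d by (simp add: d_def)
qed

section \<open>Slices in three dimensions\<close>

lemma Lnorm_lebesgue:
  fixes u :: "'a::euclidean_space \<Rightarrow> ennreal"
  assumes u: "u \<in> borel_measurable borel"
  shows "Lnorm lebesgue p u = Lnorm lborel p u"
proof -
  have "u \<in> borel_measurable lborel" "u \<in> borel_measurable lebesgue"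
    using u by (auto intro: measurable_completion)
  then have "esssup lebesgue u = esssup lborel u"
    by (simp add: esssup_eq_AE AE_completion_iff)
  then show ?thesis by (simp add: Lnorm_def nn_integral_completion)
qed

lemma Lnorm_ennreal:
  assumes "0 < p"
  shows "Lnorm M (ennreal p) u = (\<integral>\<^sup>+x. u x \<up> p \<partial>M) \<up> (1 / p)"
proof -
  have "1 / ennreal p = ennreal (1 / p)" using assms by (simp add: divide_ennreal[symmetric])
  then show ?thesis using assms by (simp add: Lnorm_def epow_eq_rpow)
qed

text \<open>The countable supremum makes \<^term>\<open>norm_x3 \<infinity> h\<close> measurable.\<close>

lemma Lnorm_infinity_continuous:
  fixes u :: "real \<Rightarrow> real"
  assumes "continuous_on UNIV u"
  shows "Lnorm lborel \<infinity> (\<lambda>x. ennreal \<bar>u x\<bar>) = (SUP q\<in>\<rat>. ennreal \<bar>u q\<bar>)"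
proof (rule antisym)
  let ?c = "SUP q\<in>\<rat>. ennreal \<bar>u q\<bar>"
  have "closed {x. ennreal \<bar>u x\<bar> \<le> ?c}"
    using assms by (intro closed_Collect_le continuous_intros continuous_on_ennreal) auto
  moreover have "\<rat> \<subseteq> {x. ennreal \<bar>u x\<bar> \<le> ?c}" by (auto intro: SUP_upper)
  ultimately have "closure \<rat> \<subseteq> {x. ennreal \<bar>u x\<bar> \<le> ?c}" by (rule closure_minimal[rotated])
  then have "ennreal \<bar>u x\<bar> \<le> ?c" for x by (auto simp: Rats_closure_real)
  moreover have "(\<lambda>x. ennreal \<bar>u x\<bar>) \<in> borel_measurable lborel"
    using borel_measurable_continuous_onI[OF assms] by measurable
  ultimately show "Lnorm lborel \<infinity> (\<lambda>x. ennreal \<bar>u x\<bar>) \<le> ?c"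
    by (auto simp: Lnorm_def intro!: esssup_I)
  show "?c \<le> Lnorm lborel \<infinity> (\<lambda>x. ennreal \<bar>u x\<bar>)"
    by (intro SUP_least abs_le_Lnorm_infinity assms)
qed

definition slice :: "(R3 \<Rightarrow> real) \<Rightarrow> real \<times> real \<Rightarrow> real \<Rightarrow> real" where
  "slice h y x3 = h (fst y, snd y, x3)"

lemma continuous_slice:
  assumes "continuous_on UNIV h" shows "continuous_on UNIV (slice h y)"
  unfolding slice_def by (intro continuous_on_compose2[OF assms] continuous_intros) auto

lemma slice_measurable [measurable]:
  assumes [measurable]: "h \<in> borel_measurable borel"
  shows "(\<lambda>z. slice h (fst z) (snd z)) \<in> borel_measurable borel"
    "slice h y \<in> borel_measurable borel" "(\<lambda>y. slice h y x3) \<in> borel_measurable borel"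
  unfolding slice_def borel_prod[symmetric] by measurable

lemma norm_x3_eq_slice:
  assumes "h \<in> borel_measurable borel"
  shows "norm_x3 p h y = Lnorm lborel p (\<lambda>x3. ennreal \<bar>slice h y x3\<bar>)"
  using slice_measurable(2)[OF assms, of y, unfolded slice_def[abs_def]]
  by (subst Lnorm_lebesgue[symmetric]) (auto simp: norm_x3_def slice_def case_prod_beta)

lemma norm_x3_measurable:
  assumes c: "continuous_on UNIV h" and p: "1 \<le> p"
  shows "norm_x3 p h \<in> borel_measurable borel"
proof -
  have h [measurable]: "h \<in> borel_measurable borel" using c by (rule borel_measurable_continuous_onI)
  have eq: "norm_x3 p h = (\<lambda>y. Lnorm lborel p (\<lambda>x3. ennreal \<bar>slice h y x3\<bar>))"
    using norm_x3_eq_slice[OF h] by auto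
  show ?thesis
  proof (cases "p = \<infinity>")
    case True
    have "(\<lambda>y. SUP q\<in>\<rat>. ennreal \<bar>slice h y q\<bar>) \<in> borel_measurable borel"
      by (intro borel_measurable_SUP countable_rat) measurable
    then show ?thesis unfolding eq unfolding True by (simp add: Lnorm_infinity_continuous continuous_slice c del: infinity_ennreal_def)
  next
    case False
    then obtain p' where p': "p = ennreal p'" "0 < p'" using p
      by (cases p) (auto simp: top_unique)
    have "(\<lambda>y. \<integral>\<^sup>+x3. ennreal \<bar>slice h y x3\<bar> \<up> p' \<partial>lborel) \<in> borel_measurable borel"
      using slice_measurable(1)[OF h]
        nn_integral_lborel_prod_measurable[of "\<lambda>z. ennreal \<bar>slice h (fst z) (snd z)\<bar> \<up> p'"] by simp
    then show ?thesis unfolding eq unfolding p'(1) Lnorm_ennreal[OF p'(2)] by measurable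
  qed
qed

lemma nn_integral_R3:
  fixes F :: "R3 \<Rightarrow> ennreal"
  assumes F [measurable]: "F \<in> borel_measurable borel"
  shows "(\<integral>\<^sup>+x. F x \<partial>lborel) = (\<integral>\<^sup>+x3. \<integral>\<^sup>+y. F (fst y, snd y, x3) \<partial>lborel \<partial>lborel)"
proof -
  have m: "(\<lambda>w. F (x1, w)) \<in> borel_measurable borel" for x1
    by measurable
  have g: "(\<lambda>w. F (fst (fst w), snd (fst w), snd w)) \<in> borel_measurable borel"
    by (intro measurable_compose[OF _ F] borel_measurable_continuous_onI continuous_intros)
  have G: "(\<lambda>y. \<integral>\<^sup>+x3. F (fst y, snd y, x3) \<partial>lborel) \<in> borel_measurable borel"
    using nn_integral_lborel_prod_measurable[OF g] by simp
  have "(\<integral>\<^sup>+x. F x \<partial>lborel) = (\<integral>\<^sup>+x1. \<integral>\<^sup>+x2. \<integral>\<^sup>+x3. F (x1, x2, x3) \<partial>lborel \<partial>lborel \<partial>lborel)"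
    by (subst nn_integral_lborel_prod(1)[OF F], subst nn_integral_lborel_prod(1)[OF m]) simp
  also have "\<dots> = (\<integral>\<^sup>+w. F (fst (fst w), snd (fst w), snd w) \<partial>lborel)"
    using nn_integral_lborel_prod(1)[OF g] nn_integral_lborel_prod(1)[OF G] by simp
  also have "\<dots> = (\<integral>\<^sup>+x3. \<integral>\<^sup>+y. F (fst y, snd y, x3) \<partial>lborel \<partial>lborel)"
    by (subst nn_integral_lborel_prod(2)[OF g]) simp
  finally show ?thesis .
qed

lemma C1_along_line:
  assumes "C1_along e h"
  shows "((\<lambda>u. h (x + u *\<^sub>R e)) has_real_derivative partial e h (x + t *\<^sub>R e)) (at t)"
proof -
  have "((\<lambda>u. h ((x + t *\<^sub>R e) + u *\<^sub>R e)) has_real_derivative partial e h (x + t *\<^sub>R e)) (at 0)"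
    using assms unfolding C1_along_def partial_def
    by (intro DERIV_deriv_iff_real_differentiable[THEN iffD2]) blast
  then have "((\<lambda>u. h ((x + t *\<^sub>R e) + (u - t) *\<^sub>R e)) has_real_derivative partial e h (x + t *\<^sub>R e)) (at t)"
    using DERIV_shift[of "\<lambda>u. h ((x + t *\<^sub>R e) + (u - t) *\<^sub>R e)" _ 0 t] by (simp add: add.commute)
  then show ?thesis by (simp add: algebra_simps)
qed

lemma C1_along_e3_slice:
  assumes "C1_along e3 \<phi>"
  shows "(slice \<phi> y has_real_derivative slice (partial e3 \<phi>) y t) (at t)"
  using C1_along_line[OF assms, of "(fst y, snd y, 0)" t] by (simp add: slice_def[abs_def] e3_def)

lemma C1_along_planar:
  assumes "C1_along e1 f" "C1_along e2 f"
  shows "planar_C1 (\<lambda>y. slice f y x3) (\<lambda>y. slice (partial e1 f) y x3) (\<lambda>y. slice (partial e2 f) y x3)"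
  unfolding planar_C1_def
proof (intro conjI allI)
  have c: "continuous_on UNIV (\<lambda>y. slice h y x3)" if "continuous_on UNIV h" for h
    unfolding slice_def by (intro continuous_on_compose2[OF that] continuous_intros) auto
  show "continuous_on UNIV (\<lambda>y. slice f y x3)" "continuous_on UNIV (\<lambda>y. slice (partial e1 f) y x3)"
    "continuous_on UNIV (\<lambda>y. slice (partial e2 f) y x3)"
    using assms by (auto simp: C1_along_def intro!: c)
  show "((\<lambda>x. slice f (x, b) x3) has_real_derivative slice (partial e1 f) (a, b) x3) (at a)" for a b
    using C1_along_line[OF assms(1), of "(0, b, x3)" a] by (simp add: slice_def e1_def)
  show "((\<lambda>x. slice f (a, x) x3) has_real_derivative slice (partial e2 f) (a, b) x3) (at b)" for a b
    using C1_along_line[OF assms(2), of "(a, 0, x3)" b] by (simp add: slice_def e2_def)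
qed

section \<open>The outer norms\<close>

lemma AE_finite_of_Lnorm:
  assumes [measurable]: "u \<in> borel_measurable M" and p: "p \<noteq> 0" and fin: "Lnorm M p u < \<infinity>"
  shows "AE x in M. u x < \<infinity>"
proof (cases "p = \<infinity>")
  case True
  then have "esssup M u < \<infinity>" using fin by (simp add: Lnorm_def)
  then show ?thesis using esssup_AE[of u M] by (auto elim!: eventually_mono)
next
  case False
  then obtain p' where p': "p = ennreal p'" "0 < p'" using p
    by (cases p) (auto simp: zero_less_iff_neq_zero)
  have "(\<integral>\<^sup>+x. u x \<up> p' \<partial>M) \<noteq> \<infinity>"
    using fin p' by (simp add: Lnorm_ennreal rpow_less_top_iff less_top)
  then have "AE x in M. u x \<up> p' \<noteq> \<infinity>" by (intro nn_integral_noteq_infinite) auto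
  then show ?thesis
    by eventually_elim (use p' rpow_less_top_iff[of p'] in \<open>simp add: less_top\<close>)
qed

text \<open>The function of \<open>y\<close> whose norm \<^const>\<open>norm_x12_pow\<close> takes: with \<open>x = H y\<close> and \<open>\<rho> = 1 / r\<close>, the
  \<open>L\<^bsup>r t\<^esup>\<close> norm of this function is \<^term>\<open>norm_x12_pow (ennreal c) r t H\<close>, or at most this if
  \<open>c = 0\<close> and \<open>r t = \<infinity>\<close>.\<close>

definition pointwise_pow :: "real \<Rightarrow> real \<Rightarrow> ennreal \<Rightarrow> ennreal" where
  "pointwise_pow c \<rho> x = (if c = 0 then (if x = 0 then 0 else 1) \<up> \<rho> else x \<up> (c * (1 - \<rho>)))"

lemma ennreal_one_divide_gt_2:
  assumes "2 < r" obtains \<rho> where "0 \<le> \<rho>" "\<rho> < 1 / 2" "1 / r = ennreal \<rho>"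
    "quot_minus r 1 = ennreal (1 - \<rho>)" "quot_minus r 2 = ennreal (1 - 2 * \<rho>)"
    "1 / (r - 1) = ennreal (\<rho> / (1 - \<rho>))" "r = \<infinity> \<longleftrightarrow> \<rho> = 0" "r \<noteq> \<infinity> \<Longrightarrow> r = ennreal (1 / \<rho>)"
proof (cases "r = \<infinity>")
  case True
  then show ?thesis using that[of 0] by (auto simp: quot_minus_def ennreal_top_minus)
next
  case False
  then obtain r' where r': "r = ennreal r'" "2 < r'" using assms
    by (cases r) (auto simp flip: ennreal_numeral simp: ennreal_less_iff)
  have m: "r - 1 = ennreal (r' - 1)" "r - 2 = ennreal (r' - 2)"
    using r' by (simp_all add: ennreal_minus[symmetric])
  have "quot_minus r 1 = ennreal (1 - 1 / r')" "quot_minus r 2 = ennreal (1 - 2 * (1 / r'))"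
    using m r' by (simp_all add: quot_minus_def divide_ennreal diff_divide_distrib)
  moreover have "1 / r = ennreal (1 / r')" using r' by (simp add: divide_ennreal[symmetric])
  moreover have "1 / (r - 1) = ennreal ((1 / r') / (1 - 1 / r'))"
    unfolding m(1) using r' divide_ennreal[of 1 "r' - 1"] by (simp add: field_simps)
  ultimately show ?thesis using that[of "1 / r'"] r' by (auto simp: field_simps)
qed

text \<open>The analogue of \<open>Lnorm_majorant\<close>, with weight \<open>1 / (r t)\<close>: \<open>U\<close> is the indicator of \<open>H \<noteq> 0\<close> for \<open>c = 0\<close>
  and the power of \<open>H\<close> that the norm integrates for \<open>c > 0\<close>, except that \<open>U = 0\<close> and \<open>k\<close> is a power of
  the essential supremum when the exponent \<open>c (r - 1) t\<close> is infinite. Finiteness of \<open>H\<close> almost everywhere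
  puts almost all the slices of \<open>\<phi>\<close> into \<open>L\<^sup>s\<close>.\<close>

lemma norm_x12_pow_majorant:
  assumes H [measurable]: "H \<in> borel_measurable borel" and c: "0 \<le> c" and r: "2 < r" "1 / r = ennreal \<rho>"
    and t: "1 \<le> t" "1 / t = ennreal \<tau>" "0 \<le> \<tau>" and \<rho>0: "0 \<le> \<rho>"
    and fin: "norm_x12_pow (ennreal c) r t H < \<infinity>"
  obtains U k where "U \<in> borel_measurable borel"
    "AE y in lborel. pointwise_pow c \<rho> (H y) \<le> k * U y \<up> (\<rho> * \<tau>)"
    "k * (\<integral>\<^sup>+y. U y \<partial>lborel) \<up> (\<rho> * \<tau>) \<le> norm_x12_pow (ennreal c) r t H"
    "c \<noteq> 0 \<longrightarrow> (AE y in lborel. H y < \<infinity>)"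
proof -
  obtain \<rho>' where \<rho>': "0 \<le> \<rho>'" "\<rho>' < 1 / 2" "1 / r = ennreal \<rho>'"
    "quot_minus r 1 = ennreal (1 - \<rho>')" "r = \<infinity> \<longleftrightarrow> \<rho>' = 0" "r \<noteq> \<infinity> \<Longrightarrow> r = ennreal (1 / \<rho>')"
    using ennreal_one_divide_gt_2[OF r(1)] by metis
  have "\<rho>' = \<rho>" using \<rho>' r(2) \<rho>0 by simp
  note \<rho> = \<rho>'[unfolded this]
  obtain \<tau>' where \<tau>': "1 / t = ennreal \<tau>'" "0 \<le> \<tau>'" "\<tau>' = 0 \<longleftrightarrow> t = \<infinity>" "t \<noteq> \<infinity> \<Longrightarrow> t = ennreal (1 / \<tau>')"
    using ennreal_one_divide[OF t(1)] by metis
  have "\<tau>' = \<tau>" using \<tau>' t by simp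
  note \<tau> = \<tau>'[unfolded this]
  have rt: "1 / (r * t) = ennreal (\<rho> * \<tau>)"
    using ennreal_inverse_mult'[of r t] r t \<rho> \<tau> by (auto simp: divide_ennreal_def ennreal_mult mult.commute)
  show thesis
  proof (cases "c = 0")
    case True
    let ?S = "{y. H y \<noteq> 0}"
    have S: "?S \<in> sets borel" by measurable
    have ind: "(if x = 0 then 0 else 1) \<up> \<rho> \<le> (if x = 0 then 0 else 1 :: ennreal) \<up> (\<rho> * \<tau>)" for x :: ennreal
      using zero_rpow[of \<rho>] by (cases "\<rho> = 0") auto
    have "(\<integral>\<^sup>+y. indicator ?S y \<partial>lborel) \<up> (\<rho> * \<tau>) = norm_x12_pow (ennreal c) r t H"
      using True rt S \<rho> \<tau> by (simp add: norm_x12_pow_def epow_eq_rpow)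
    then show thesis
      using True ind[of 0] S by (intro that[of "indicator ?S" 1]) (auto simp: pointwise_pow_def indicator_def)
  next
    case False
    then have c: "0 < c" using c by simp
    define P where "P = ennreal c * (r - 1) * t"
    define w where "w = c * (1 - \<rho>)"
    have w: "0 < w" using c \<rho> by (simp add: w_def)
    have N: "norm_x12_pow (ennreal c) r t H = Lnorm lborel P H \<up> w"
      using c \<rho> unfolding norm_x12_pow_def norm_x12_def P_def[symmetric]
      by (simp add: Lnorm_lebesgue[OF H] w_def ennreal_mult[symmetric] epow_eq_rpow)
    have r1: "r - 1 \<noteq> 0" using r(1) by (auto simp: diff_eq_0_iff_ennreal dest: order_less_le_trans)
    have P0: "P \<noteq> 0" using c r1 t(1) by (auto simp: P_def)
    have "Lnorm lborel P H < \<infinity>" using fin[unfolded N] w by (simp add: rpow_less_top_iff)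
    then have AEf: "AE y in lborel. H y < \<infinity>" using P0 by (intro AE_finite_of_Lnorm) auto
    show thesis
    proof (cases "\<rho> * \<tau> = 0")
      case True
      then have "r = \<infinity> \<or> t = \<infinity>" using \<rho> \<tau> by auto
      then have P: "P = \<infinity>" using c r1 t(1)
        by (auto simp: P_def ennreal_mult_top ennreal_top_mult ennreal_top_minus)
      have "AE y in lborel. pointwise_pow c \<rho> (H y) \<le> Lnorm lborel P H \<up> w * 0 \<up> (\<rho> * \<tau>)"
        using esssup_AE[of H lborel] by eventually_elim
          (use False True w P in \<open>auto simp: pointwise_pow_def w_def[symmetric] Lnorm_def intro!: rpow_mono\<close>)
      then show thesis using that[of "\<lambda>_. 0" "Lnorm lborel P H \<up> w"] AEf N True by simp
    next
      case False
      then have rt': "r = ennreal (1 / \<rho>)" "t = ennreal (1 / \<tau>)" "0 < \<rho>" "0 < \<tau>" using \<rho> \<tau> by auto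
      define p where "p = c * (1 / \<rho> - 1) * (1 / \<tau>)"
      have r1': "0 < 1 / \<rho> - 1" using rt'(3) \<rho>(2) by (simp add: less_divide_eq)
      then have p: "0 < p" unfolding p_def using c rt'(4) by (intro mult_pos_pos) auto
      have "r - 1 = ennreal (1 / \<rho> - 1)" unfolding rt'(1) using ennreal_minus[of 1 "1 / \<rho>"] by simp
      then have P: "P = ennreal p"
        using c r1' rt'(3,4) unfolding P_def p_def rt'(2) by (simp add: ennreal_mult[symmetric])
      have e1: "w = p * (\<rho> * \<tau>)"
        using rt'(3,4) by (simp add: w_def p_def field_simps)
      then have e: "w = p * (\<rho> * \<tau>)" "1 / p * w = \<rho> * \<tau>" using p by auto
      have "Lnorm lborel P H \<up> w = (\<integral>\<^sup>+y. H y \<up> p \<partial>lborel) \<up> (\<rho> * \<tau>)"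
        unfolding P Lnorm_ennreal[OF p] rpow_rpow e(2) ..
      moreover have "pointwise_pow c \<rho> (H y) = (H y \<up> p) \<up> (\<rho> * \<tau>)" for y
        using c unfolding pointwise_pow_def rpow_rpow e(1)[symmetric] by (simp add: w_def)
      ultimately show thesis using that[of "\<lambda>y. H y \<up> p" 1] AEf N by simp
    qed
  qed
qed

section \<open>The estimate\<close>

lemma slice_zero_of_norm_x3_zero:
  assumes c: "continuous_on UNIV \<phi>" and s: "1 \<le> s" and z: "norm_x3 s \<phi> y = 0"
  shows "slice \<phi> y x3 = 0"
proof -
  have [measurable]: "\<phi> \<in> borel_measurable borel" using c by (rule borel_measurable_continuous_onI)
  have L: "Lnorm lborel s (\<lambda>x3. ennreal \<bar>slice \<phi> y x3\<bar>) = 0" using z by (simp add: norm_x3_eq_slice)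
  have "AE x3 in lborel. ennreal \<bar>slice \<phi> y x3\<bar> \<le> 0"
  proof (cases "s = \<infinity>")
    case True
    then show ?thesis using L abs_le_Lnorm_infinity[OF continuous_slice[OF c]]
      by (intro AE_I2) (metis)
  next
    case False
    then obtain p where p: "s = ennreal p" "0 < p" using s by (cases s) (auto simp: top_unique)
    then have "(\<integral>\<^sup>+x3. ennreal \<bar>slice \<phi> y x3\<bar> \<up> p \<partial>lborel) = 0"
      using L by (simp add: Lnorm_ennreal rpow_eq_0_iff)
    then have "AE x3 in lborel. ennreal \<bar>slice \<phi> y x3\<bar> \<up> p = 0"
      by (subst (asm) nn_integral_0_iff_AE) auto
    then show ?thesis by eventually_elim (use p in \<open>auto simp: rpow_eq_0_iff\<close>)
  qed
  from AE_le_imp_le_continuous[OF continuous_slice[OF c] this] show ?thesis by simp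
qed

text \<open>The interpolation inequality with \<open>\<mu> = \<rho> + \<theta> (1 - \<rho>)\<close>. The indicator that replaces a power \<open>0\<close>
  costs nothing: for \<open>\<theta> = 0\<close> it multiplies \<open>A\<^sup>\<rho>\<close>, which already vanishes with \<open>A\<close> if
  \<open>\<rho> > 0\<close>, while for \<open>\<rho> = 0\<close> the power \<open>\<rho>\<close> of the indicator is \<open>1\<close>; for \<open>\<theta> = 1\<close> it vanishes only where the whole slice of \<open>\<phi>\<close> does.\<close>

lemma slice_sup_bound:
  assumes \<phi>: "C1_along e3 \<phi>"
    and \<alpha>: "1 \<le> \<alpha>" "1 / \<alpha> = ennreal (1 - \<kappa>)" "0 \<le> \<kappa>" "\<kappa> \<le> 1" "\<kappa> = 0 \<longleftrightarrow> \<alpha> = 1"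
    and s: "1 \<le> s" "1 / s = ennreal \<sigma>" "0 \<le> \<sigma>" "\<sigma> = 0 \<longleftrightarrow> s = \<infinity>" "s \<noteq> \<infinity> \<Longrightarrow> s = ennreal (1 / \<sigma>)"
    and \<rho>: "0 \<le> \<rho>" "\<rho> < 1" and \<theta>: "0 \<le> \<theta>" "\<theta> \<le> 1"
    and rel: "(\<rho> / (1 - \<rho>) + \<theta>) * \<kappa> = (1 - \<theta>) * \<sigma>"
    and lim: "\<alpha> = 1 \<Longrightarrow> (slice \<phi> y \<longlongrightarrow> 0) at_infinity"
    and fin: "\<theta> < 1 \<Longrightarrow> norm_x3 s \<phi> y < \<infinity>"
  shows "ennreal \<bar>slice \<phi> y x3\<bar> \<le> ennreal (max 1 (1 / (\<rho> + \<theta> * (1 - \<rho>)))) *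
    (norm_x3 \<alpha> (partial e3 \<phi>) y \<up> \<rho> * pointwise_pow \<theta> \<rho> (norm_x3 \<alpha> (partial e3 \<phi>) y)
      * pointwise_pow (1 - \<theta>) \<rho> (norm_x3 s \<phi> y))"
proof -
  define \<mu> where "\<mu> = \<rho> + \<theta> * (1 - \<rho>)"
  have \<mu>1: "1 - \<mu> = (1 - \<theta>) * (1 - \<rho>)" by (simp add: \<mu>_def algebra_simps)
  have \<mu>: "0 \<le> \<mu>" "\<mu> \<le> 1" using \<rho> \<theta> \<mu>1 by (simp_all add: \<mu>_def) (metis diff_ge_0_iff_ge less_imp_le mult_nonneg_nonneg)
  have "\<mu> = (1 - \<rho>) * (\<rho> / (1 - \<rho>) + \<theta>)" using \<rho> by (simp add: \<mu>_def field_simps)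
  then have rel': "\<mu> * \<kappa> = (1 - \<mu>) * \<sigma>" unfolding \<mu>1 using rel by (metis mult.assoc mult.commute)
  have c: "continuous_on UNIV \<phi>" "continuous_on UNIV (partial e3 \<phi>)" using \<phi> by (auto simp: C1_along_def)
  have m: "\<phi> \<in> borel_measurable borel" "partial e3 \<phi> \<in> borel_measurable borel"
    using c by (auto intro: borel_measurable_continuous_onI)
  let ?A = "norm_x3 \<alpha> (partial e3 \<phi>) y" and ?S = "norm_x3 s \<phi> y"
  have "ennreal \<bar>slice \<phi> y x3\<bar> \<le> ennreal (max 1 (1 / \<mu>)) * (?A \<up> \<mu> * ?S \<up> (1 - \<mu>))"
    unfolding norm_x3_eq_slice[OF m(1)] norm_x3_eq_slice[OF m(2)]
  proof (rule sup_interpolation[OF C1_along_e3_slice[OF \<phi>] continuous_slice[OF c(2)] \<alpha> s \<mu> rel' lim])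
    assume "\<mu> < 1"
    then have "\<theta> < 1" using \<theta> \<mu>1 by (cases "\<theta> = 1") auto
    then show "Lnorm lborel s (\<lambda>x. ennreal \<bar>slice \<phi> y x\<bar>) < \<infinity>"
      using fin norm_x3_eq_slice[OF m(1)] by simp
  qed
  moreover have "?A \<up> \<mu> = ?A \<up> \<rho> * pointwise_pow \<theta> \<rho> ?A"
  proof (cases "\<theta> = 0")
    case True
    then show ?thesis by (cases "\<rho> = 0") (auto simp: \<mu>_def pointwise_pow_def zero_rpow)
  next
    case False
    then show ?thesis using \<rho> \<theta> by (simp add: \<mu>_def pointwise_pow_def rpow_add)
  qed
  moreover have "?S \<up> (1 - \<mu>) = pointwise_pow (1 - \<theta>) \<rho> ?S" if "?S \<noteq> 0"
    using that by (cases "\<theta> = 1") (auto simp: \<mu>1 pointwise_pow_def)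
  ultimately show ?thesis
    using slice_zero_of_norm_x3_zero[OF c(1) s(1), of y x3] by (cases "?S = 0") (auto simp: \<mu>_def)
qed

lemma AE_slice_integral_finite:
  fixes F :: "R3 \<Rightarrow> ennreal"
  assumes [measurable]: "F \<in> borel_measurable borel" and "(\<integral>\<^sup>+x. F x \<partial>lborel) < \<infinity>"
  shows "AE x3 in lborel. (\<integral>\<^sup>+y. F (fst y, snd y, x3) \<partial>lborel) < \<infinity>"
proof -
  have "(\<lambda>w. F (fst (snd w), snd (snd w), fst w)) \<in> borel_measurable borel"
    by (intro measurable_compose[OF _ assms(1)] borel_measurable_continuous_onI continuous_intros)
  from nn_integral_lborel_prod_measurable[OF this]
  have "AE x3 in lborel. (\<integral>\<^sup>+y. F (fst y, snd y, x3) \<partial>lborel) \<noteq> \<infinity>"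
    using assms(2) nn_integral_R3[OF assms(1)] by (intro nn_integral_noteq_infinite) auto
  then show ?thesis by (simp add: less_top)
qed

definition square_integral :: "(R3 \<Rightarrow> real) \<Rightarrow> ennreal" where
  "square_integral h = (\<integral>\<^sup>+x. ennreal \<bar>h x\<bar> \<up> 2 \<partial>lborel)"

lemma square_integral_slices:
  assumes [measurable]: "h \<in> borel_measurable borel"
  shows "square_integral h = (\<integral>\<^sup>+x3. power_integral 2 (\<lambda>y. slice h y x3) \<partial>lborel)"
    "(\<lambda>x3. power_integral p (\<lambda>y. slice h y x3)) \<in> borel_measurable borel"
proof -
  have "(\<lambda>x. ennreal \<bar>h x\<bar> \<up> p) \<in> borel_measurable borel" for p by measurable
  note m = this
  show "square_integral h = (\<integral>\<^sup>+x3. power_integral 2 (\<lambda>y. slice h y x3) \<partial>lborel)"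
    unfolding square_integral_def power_integral_def slice_def by (rule nn_integral_R3[OF m])
  have "(\<lambda>w. ennreal \<bar>h (fst (snd w), snd (snd w), fst w)\<bar> \<up> p) \<in> borel_measurable borel"
    by (intro measurable_compose[OF _ m] borel_measurable_continuous_onI continuous_intros)
  from nn_integral_lborel_prod_measurable[OF this]
  show "(\<lambda>x3. power_integral p (\<lambda>y. slice h y x3)) \<in> borel_measurable borel"
    by (simp add: power_integral_def slice_def)
qed

text \<open>The bound on \<open>\<bar>\<phi>\<bar>\<close> does not depend on \<open>x\<^sub>3\<close>, so Hoelder in \<open>y\<close>, with weights
  \<open>2 w\<^sub>1\<close>, \<open>2 w\<^sub>2\<close>, \<open>2 w\<^sub>3\<close> and \<open>1 - 2 \<rho>\<close>, turns it into constants before \<open>x\<^sub>3\<close> is integrated out.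
  On the plane \<open>x\<^sub>3 = const\<close> only a norm of the slice of \<open>f\<close> is left, to which the
  planar inequality applies.\<close>

lemma square_integral_product_bound:
  assumes \<rho>: "0 \<le> \<rho>" "\<rho> < 1 / 2"
    and planar: "\<And>h h1 h2. planar_C1 h h1 h2 \<Longrightarrow> power_integral 2 h < \<infinity> \<Longrightarrow>
      power_integral (2 / (1 - 2 * \<rho>)) h \<up> (1 - 2 * \<rho>)
      \<le> ennreal C * (power_integral 2 h \<up> (1 - 2 * \<rho>) * power_integral 2 h1 \<up> \<rho> * power_integral 2 h2 \<up> \<rho>)"
    and f: "C1_along e1 f" "C1_along e2 f" "square_integral f < \<infinity>"
    and \<phi> [measurable]: "\<phi> \<in> borel_measurable borel"
    and U [measurable]: "U1 \<in> borel_measurable borel" "U2 \<in> borel_measurable borel" "U3 \<in> borel_measurable borel"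
    and w: "0 \<le> w1" "0 \<le> w2" "0 \<le> w3" "w1 + w2 + w3 = \<rho>"
    and le: "AE y in lborel. \<forall>x3. ennreal \<bar>slice \<phi> y x3\<bar> \<le> k * (U1 y \<up> w1 * U2 y \<up> w2 * U3 y \<up> w3)"
  shows "square_integral (\<lambda>x. \<phi> x * f x) \<le> k \<up> 2 *
    ((\<integral>\<^sup>+y. U1 y \<partial>lborel) \<up> (2 * w1) * (\<integral>\<^sup>+y. U2 y \<partial>lborel) \<up> (2 * w2) * (\<integral>\<^sup>+y. U3 y \<partial>lborel) \<up> (2 * w3)) *
    (ennreal C * (square_integral f \<up> (1 - 2 * \<rho>) * square_integral (partial e1 f) \<up> \<rho>
      * square_integral (partial e2 f) \<up> \<rho>))"
proof -
  have [measurable]: "f \<in> borel_measurable borel" "partial e1 f \<in> borel_measurable borel" "partial e2 f \<in> borel_measurable borel"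
    using f by (auto simp: C1_along_def intro: borel_measurable_continuous_onI)
  define q where "q = 2 / (1 - 2 * \<rho>)"
  have q: "q * (1 - 2 * \<rho>) = 2" using \<rho> by (simp add: q_def field_simps)
  have e: "(x \<up> q) \<up> (1 - 2 * \<rho>) = x \<up> 2" for x unfolding rpow_rpow q ..
  let ?U = "(\<integral>\<^sup>+y. U1 y \<partial>lborel) \<up> (2 * w1) * (\<integral>\<^sup>+y. U2 y \<partial>lborel) \<up> (2 * w2) * (\<integral>\<^sup>+y. U3 y \<partial>lborel) \<up> (2 * w3)"
  let ?P = "\<lambda>p h x3. power_integral p (\<lambda>y. slice h y x3)"
  have slice_bound: "?P 2 (\<lambda>x. \<phi> x * f x) x3 \<le> k \<up> 2 * (?U * ?P q f x3 \<up> (1 - 2 * \<rho>))" for x3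
  proof -
    have "?P 2 (\<lambda>x. \<phi> x * f x) x3 \<le> (\<integral>\<^sup>+y. k \<up> 2 * (U1 y \<up> (2 * w1) * (U2 y \<up> (2 * w2) *
        (U3 y \<up> (2 * w3) * (ennreal \<bar>slice f y x3\<bar> \<up> q) \<up> (1 - 2 * \<rho>)))) \<partial>lborel)"
      unfolding power_integral_def
    proof (intro nn_integral_mono_AE, use le in eventually_elim)
      case (elim y)
      have "ennreal \<bar>slice (\<lambda>x. \<phi> x * f x) y x3\<bar> \<up> 2 = ennreal \<bar>slice \<phi> y x3\<bar> \<up> 2 * ennreal \<bar>slice f y x3\<bar> \<up> 2"
        by (simp add: slice_def abs_mult ennreal_mult rpow_mult)
      also have "\<dots> \<le> (k * (U1 y \<up> w1 * U2 y \<up> w2 * U3 y \<up> w3)) \<up> 2 * ennreal \<bar>slice f y x3\<bar> \<up> 2"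
        using elim by (intro mult_right_mono rpow_mono) auto
      also have "\<dots> = k \<up> 2 * (U1 y \<up> (2 * w1) * (U2 y \<up> (2 * w2) *
        (U3 y \<up> (2 * w3) * (ennreal \<bar>slice f y x3\<bar> \<up> q) \<up> (1 - 2 * \<rho>))))"
        unfolding e by (simp add: rpow_mult rpow_rpow ac_simps)
      finally show ?case .
    qed
    also have "\<dots> = k \<up> 2 * (\<integral>\<^sup>+y. (U1 y \<up> (2 * w1) * (U2 y \<up> (2 * w2) *
        (U3 y \<up> (2 * w3) * (ennreal \<bar>slice f y x3\<bar> \<up> q) \<up> (1 - 2 * \<rho>)))) \<partial>lborel)"
      by (rule nn_integral_cmult) measurable
    also have "\<dots> \<le> k \<up> 2 * (?U * ?P q f x3 \<up> (1 - 2 * \<rho>))"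
    proof (rule mult_left_mono)
      let ?xs = "[(U1, 2 * w1), (U2, 2 * w2), (U3, 2 * w3), (\<lambda>y. ennreal \<bar>slice f y x3\<bar> \<up> q, 1 - 2 * \<rho>)]"
      have "u \<in> borel_measurable lborel \<and> 0 \<le> v" if "(u, v) \<in> set ?xs" for u v
        using that w(1-3) \<rho> by auto
      moreover have "sum_list (map snd ?xs) = 1" using w(4) by simp
      ultimately show "(\<integral>\<^sup>+y. (U1 y \<up> (2 * w1) * (U2 y \<up> (2 * w2) *
          (U3 y \<up> (2 * w3) * (ennreal \<bar>slice f y x3\<bar> \<up> q) \<up> (1 - 2 * \<rho>)))) \<partial>lborel)
          \<le> ?U * ?P q f x3 \<up> (1 - 2 * \<rho>)"
        using Hoelder_list[of ?xs lborel] by (simp add: power_integral_def mult.assoc)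
    qed simp
    finally show ?thesis .
  qed
  have Pf: "AE x3 in lborel. ?P 2 f x3 < \<infinity>"
    using f(3) unfolding square_integral_def power_integral_def slice_def
    by (intro AE_slice_integral_finite) auto
  have "square_integral (\<lambda>x. \<phi> x * f x) = (\<integral>\<^sup>+x3. ?P 2 (\<lambda>x. \<phi> x * f x) x3 \<partial>lborel)"
    by (rule square_integral_slices) measurable
  also have "\<dots> \<le> (\<integral>\<^sup>+x3. (k \<up> 2 * ?U * ennreal C) *
      (?P 2 f x3 \<up> (1 - 2 * \<rho>) * (?P 2 (partial e1 f) x3 \<up> \<rho> * ?P 2 (partial e2 f) x3 \<up> \<rho>)) \<partial>lborel)"
  proof (intro nn_integral_mono_AE, use Pf in eventually_elim)
    case (elim x3)
    have "?P q f x3 \<up> (1 - 2 * \<rho>)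
      \<le> ennreal C * (?P 2 f x3 \<up> (1 - 2 * \<rho>) * ?P 2 (partial e1 f) x3 \<up> \<rho> * ?P 2 (partial e2 f) x3 \<up> \<rho>)"
      unfolding q_def by (rule planar[OF C1_along_planar[OF f(1,2)] elim])
    from order_trans[OF slice_bound mult_left_mono[OF mult_left_mono[OF this]]]
    show ?case by (simp add: ac_simps)
  qed
  also have "\<dots> = (k \<up> 2 * ?U * ennreal C) * (\<integral>\<^sup>+x3. ?P 2 f x3 \<up> (1 - 2 * \<rho>) *
      (?P 2 (partial e1 f) x3 \<up> \<rho> * ?P 2 (partial e2 f) x3 \<up> \<rho>) \<partial>lborel)"
    by (intro nn_integral_cmult borel_measurable_times_ennreal rpow_measurable)
      (simp_all add: square_integral_slices)
  also have "\<dots> \<le> (k \<up> 2 * ?U * ennreal C) * (square_integral f \<up> (1 - 2 * \<rho>)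
      * (square_integral (partial e1 f) \<up> \<rho> * square_integral (partial e2 f) \<up> \<rho>))"
  proof (rule mult_left_mono)
    let ?xs = "[(?P 2 f, 1 - 2 * \<rho>), (?P 2 (partial e1 f), \<rho>), (?P 2 (partial e2 f), \<rho>)]"
    have "u \<in> borel_measurable lborel \<and> 0 \<le> v" if "(u, v) \<in> set ?xs" for u v
      using that \<rho> by (auto simp: square_integral_slices)
    then show "(\<integral>\<^sup>+x3. ?P 2 f x3 \<up> (1 - 2 * \<rho>) *
        (?P 2 (partial e1 f) x3 \<up> \<rho> * ?P 2 (partial e2 f) x3 \<up> \<rho>) \<partial>lborel)
      \<le> square_integral f \<up> (1 - 2 * \<rho>)
        * (square_integral (partial e1 f) \<up> \<rho> * square_integral (partial e2 f) \<up> \<rho>)"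
      using Hoelder_list[of ?xs lborel] by (simp add: square_integral_slices)
  qed simp
  finally show ?thesis by (simp add: ac_simps)
qed

lemma L2norm_eq:
  shows "L2norm h = (\<integral>\<^sup>+x. ennreal \<bar>h x\<bar> \<up> 2 \<partial>lebesgue) \<up> (1 / 2)"
    "L2norm h = square_integral h \<up> (1 / 2)"
proof -
  show *: "L2norm h = (\<integral>\<^sup>+x. ennreal \<bar>h x\<bar> \<up> 2 \<partial>lebesgue) \<up> (1 / 2)"
    using Lnorm_ennreal[of 2 lebesgue] by (simp add: L2norm_def)
  show "L2norm h = square_integral h \<up> (1 / 2)"
    unfolding * square_integral_def by (simp add: nn_integral_completion)
qed

lemma nn_integral_product_le_L2norm:
  assumes [measurable]: "h \<in> borel_measurable lebesgue" "g \<in> borel_measurable lebesgue"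
  shows "(\<integral>\<^sup>+x. ennreal \<bar>h x * g x\<bar> \<partial>lebesgue) \<le> L2norm h * L2norm g"
proof -
  have "(\<integral>\<^sup>+x. ennreal \<bar>h x * g x\<bar> \<partial>lebesgue)
      = (\<integral>\<^sup>+x. (ennreal \<bar>h x\<bar> \<up> 2) \<up> (1 / 2) * (ennreal \<bar>g x\<bar> \<up> 2) \<up> (1 - 1 / 2) \<partial>lebesgue)"
    by (simp add: rpow_rpow abs_mult ennreal_mult)
  also have "\<dots> \<le> L2norm h * L2norm g"
    unfolding L2norm_eq(1) using Hoelder_weighted[of "\<lambda>x. ennreal \<bar>h x\<bar> \<up> 2" lebesgue "\<lambda>x. ennreal \<bar>g x\<bar> \<up> 2" "1 / 2"]
    by simp
  finally show ?thesis .
qed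

theorem lemma2p1:
  fixes \<alpha> \<beta> s a t r :: ennreal and \<theta> :: real
  assumes "1 \<le> \<alpha>" and "1 \<le> \<beta>" and "1 \<le> s" and "1 \<le> a" and "1 \<le> t"
    and "2 < r" and "0 \<le> \<theta>" and "\<theta> \<le> 1"
    and "1 / a + 1 / t = quot_minus \<beta> 1"
    and "exponent_relation r \<alpha> s \<theta>"
  shows "\<exists>C::real. 0 < C \<and> (\<forall>\<phi> f g :: R3 \<Rightarrow> real.
    C1_along e3 \<phi> \<and> C1_along e1 f \<and> C1_along e2 f \<and> g \<in> borel_measurable lebesgue
    \<and> (\<alpha> = 1 \<longrightarrow> (AE (x1, x2) in lebesgue. ((\<lambda>x3. \<phi> (x1, x2, x3)) \<longlongrightarrow> 0) at_infinity))
    \<and> norm_x12 \<beta> (norm_x3 \<alpha> (partial e3 \<phi>)) < \<infinity>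
    \<and> norm_x12_pow (ennreal \<theta>) r t (norm_x3 \<alpha> (partial e3 \<phi>)) < \<infinity>
    \<and> norm_x12_pow (ennreal (1 - \<theta>)) r a (norm_x3 s \<phi>) < \<infinity>
    \<and> L2norm f < \<infinity> \<and> L2norm (partial e1 f) < \<infinity> \<and> L2norm (partial e2 f) < \<infinity>
    \<and> L2norm g < \<infinity>
    \<longrightarrow> integrable lebesgue (\<lambda>x. \<phi> x * f x * g x)
    \<and> ennreal \<bar>\<integral>x. \<phi> x * f x * g x \<partial>lebesgue\<bar>
      \<le> ennreal C
         * epow (norm_x12 \<beta> (norm_x3 \<alpha> (partial e3 \<phi>))) (1 / r)
         * norm_x12_pow (ennreal \<theta>) r t (norm_x3 \<alpha> (partial e3 \<phi>))
         * norm_x12_pow (ennreal (1 - \<theta>)) r a (norm_x3 s \<phi>)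
         * epow (L2norm f) (quot_minus r 2)
         * epow (L2norm (partial e1 f)) (1 / r)
         * epow (L2norm (partial e2 f)) (1 / r)
         * L2norm g)"
proof -
  obtain \<rho> where \<rho>: "0 \<le> \<rho>" "\<rho> < 1 / 2" "1 / r = ennreal \<rho>"
    "quot_minus r 2 = ennreal (1 - 2 * \<rho>)" "1 / (r - 1) = ennreal (\<rho> / (1 - \<rho>))"
    using ennreal_one_divide_gt_2[OF \<open>2 < r\<close>] by metis
  obtain a' where a': "1 / \<alpha> = ennreal a'" "0 \<le> a'" "a' \<le> 1" "quot_minus \<alpha> 1 = ennreal (1 - a')" "a' = 1 \<longleftrightarrow> \<alpha> = 1"
    using ennreal_one_divide[OF \<open>1 \<le> \<alpha>\<close>] by metis
  define \<kappa> where "\<kappa> = 1 - a'"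
  have \<kappa>: "1 / \<alpha> = ennreal (1 - \<kappa>)" "0 \<le> \<kappa>" "\<kappa> \<le> 1" "\<kappa> = 0 \<longleftrightarrow> \<alpha> = 1" "quot_minus \<alpha> 1 = ennreal \<kappa>"
    using a' by (auto simp: \<kappa>_def)
  obtain \<sigma> where \<sigma>: "1 / s = ennreal \<sigma>" "0 \<le> \<sigma>" "\<sigma> = 0 \<longleftrightarrow> s = \<infinity>" "s \<noteq> \<infinity> \<Longrightarrow> s = ennreal (1 / \<sigma>)"
    using ennreal_one_divide[OF \<open>1 \<le> s\<close>] by metis
  obtain \<beta>' where \<beta>': "1 / \<beta> = ennreal \<beta>'" "0 \<le> \<beta>'" "\<beta>' \<le> 1" "quot_minus \<beta> 1 = ennreal (1 - \<beta>')"
    using ennreal_one_divide[OF \<open>1 \<le> \<beta>\<close>] by metis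
  obtain \<tau> where \<tau>: "1 / t = ennreal \<tau>" "0 \<le> \<tau>"
    using ennreal_one_divide[OF \<open>1 \<le> t\<close>] by metis
  obtain \<eta> where \<eta>: "1 / a = ennreal \<eta>" "0 \<le> \<eta>"
    using ennreal_one_divide[OF \<open>1 \<le> a\<close>] by metis
  have "ennreal (\<eta> + \<tau>) = ennreal (1 - \<beta>')" using assms(9) \<eta> \<tau> \<beta>' by simp
  then have "\<eta> + \<tau> = 1 - \<beta>'" using \<eta> \<tau> \<beta>' by (subst (asm) ennreal_inj) auto
  \<comment> \<open>The weights of the three factors with \<open>\<phi>\<close> add up to \<open>\<rho>\<close>; doubled and added to the weight \<open>1 - 2 * \<rho>\<close>
    of \<open>f\<close>, they give \<open>1\<close>.\<close>
  then have weights: "\<rho> * \<beta>' + \<rho> * \<tau> + \<rho> * \<eta> = \<rho>" by (simp add: distrib_left[symmetric])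
  have "(1 / (r - 1) + ennreal \<theta>) * quot_minus \<alpha> 1 = ennreal (1 - \<theta>) * (1 / s)"
    using exponent_relation_iff[of \<alpha> s r \<theta>] assms by (simp add: divide_ennreal_def)
  then have "ennreal ((\<rho> / (1 - \<rho>) + \<theta>) * \<kappa>) = ennreal ((1 - \<theta>) * \<sigma>)"
    unfolding \<rho>(5) \<kappa>(5) \<sigma>(1) using \<rho> \<kappa> \<sigma> assms by (simp add: ennreal_mult)
  then have rel: "(\<rho> / (1 - \<rho>) + \<theta>) * \<kappa> = (1 - \<theta>) * \<sigma>"
    using \<rho> \<kappa> \<sigma> assms by (subst (asm) ennreal_inj) auto
  obtain C2 where C2: "0 < C2" "\<And>h h1 h2. planar_C1 h h1 h2 \<Longrightarrow> power_integral 2 h < \<infinity> \<Longrightarrow>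
    power_integral (2 / (1 - 2 * \<rho>)) h \<up> (1 - 2 * \<rho>)
    \<le> ennreal C2 * (power_integral 2 h \<up> (1 - 2 * \<rho>) * power_integral 2 h1 \<up> \<rho> * power_integral 2 h2 \<up> \<rho>)"
    using planar_interpolation[OF \<rho>(1,2)] by metis
  define C1 where "C1 = max 1 (1 / (\<rho> + \<theta> * (1 - \<rho>)))"
  have C1: "0 < C1" by (simp add: C1_def)
  show ?thesis
  proof (intro exI[of _ "C1 * C2 powr (1 / 2)"] conjI allI impI; (elim conjE)?)
    show "0 < C1 * C2 powr (1 / 2)" using C1 C2 by simp
    fix \<phi> f g :: "R3 \<Rightarrow> real"
    assume \<phi>: "C1_along e3 \<phi>" and f: "C1_along e1 f" "C1_along e2 f"
      and g [measurable]: "g \<in> borel_measurable lebesgue"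
      and lim: "\<alpha> = 1 \<longrightarrow> (AE (x1, x2) in lebesgue. ((\<lambda>x3. \<phi> (x1, x2, x3)) \<longlongrightarrow> 0) at_infinity)"
      and fin: "norm_x12 \<beta> (norm_x3 \<alpha> (partial e3 \<phi>)) < \<infinity>"
        "norm_x12_pow (ennreal \<theta>) r t (norm_x3 \<alpha> (partial e3 \<phi>)) < \<infinity>"
        "norm_x12_pow (ennreal (1 - \<theta>)) r a (norm_x3 s \<phi>) < \<infinity>"
        "L2norm f < \<infinity>" "L2norm (partial e1 f) < \<infinity>" "L2norm (partial e2 f) < \<infinity>" "L2norm g < \<infinity>"
    let ?A = "norm_x3 \<alpha> (partial e3 \<phi>)" and ?S = "norm_x3 s \<phi>"
    let ?N\<beta> = "epow (norm_x12 \<beta> ?A) (1 / r)" and ?Nt = "norm_x12_pow (ennreal \<theta>) r t ?A"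
      and ?Na = "norm_x12_pow (ennreal (1 - \<theta>)) r a ?S"
    have A [measurable]: "?A \<in> borel_measurable borel" and S [measurable]: "?S \<in> borel_measurable borel"
      using \<phi> assms by (auto simp: C1_along_def intro!: norm_x3_measurable)
    have m: "\<phi> \<in> borel_measurable borel" "f \<in> borel_measurable borel"
      using \<phi> f by (auto simp: C1_along_def intro: borel_measurable_continuous_onI)
    then have [measurable]: "\<phi> \<in> borel_measurable lebesgue" "f \<in> borel_measurable lebesgue"
      by (auto intro: measurable_completion)

    obtain U1 k1 where U1: "U1 \<in> borel_measurable borel" "AE y in lborel. ?A y \<le> k1 * U1 y \<up> \<beta>'"
      "k1 * (\<integral>\<^sup>+y. U1 y \<partial>lborel) \<up> \<beta>' \<le> Lnorm lborel \<beta> ?A"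
      using Lnorm_majorant[of ?A lborel \<beta> \<beta>'] A \<beta>' assms by auto
    have N\<beta>: "?N\<beta> = Lnorm lborel \<beta> ?A \<up> \<rho>"
      using \<rho> by (simp add: norm_x12_def Lnorm_lebesgue epow_eq_rpow)
    have k1: "k1 \<up> \<rho> * (\<integral>\<^sup>+y. U1 y \<partial>lborel) \<up> (\<rho> * \<beta>') \<le> ?N\<beta>"
      using rpow_mono[OF U1(3) \<rho>(1)] unfolding N\<beta> by (simp add: rpow_mult rpow_rpow mult.commute)
    obtain U2 k2 where U2: "U2 \<in> borel_measurable borel"
      "AE y in lborel. pointwise_pow \<theta> \<rho> (?A y) \<le> k2 * U2 y \<up> (\<rho> * \<tau>)"
      "k2 * (\<integral>\<^sup>+y. U2 y \<partial>lborel) \<up> (\<rho> * \<tau>) \<le> ?Nt"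
      by (rule norm_x12_pow_majorant[OF A \<open>0 \<le> \<theta>\<close> \<open>2 < r\<close> \<rho>(3) \<open>1 \<le> t\<close> \<tau> \<rho>(1) fin(2)])
    have \<theta>': "0 \<le> 1 - \<theta>" using \<open>\<theta> \<le> 1\<close> by simp
    obtain U3 k3 where U3: "U3 \<in> borel_measurable borel"
      "AE y in lborel. pointwise_pow (1 - \<theta>) \<rho> (?S y) \<le> k3 * U3 y \<up> (\<rho> * \<eta>)"
      "k3 * (\<integral>\<^sup>+y. U3 y \<partial>lborel) \<up> (\<rho> * \<eta>) \<le> ?Na"
      and Sfin: "1 - \<theta> \<noteq> 0 \<longrightarrow> (AE y in lborel. ?S y < \<infinity>)"
      by (rule norm_x12_pow_majorant[OF S \<theta>' \<open>2 < r\<close> \<rho>(3) \<open>1 \<le> a\<close> \<eta> \<rho>(1) fin(3)])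

    have lim': "AE y in lborel. \<alpha> = 1 \<longrightarrow> (slice \<phi> y \<longlongrightarrow> 0) at_infinity"
      using lim by (cases "\<alpha> = 1") (auto simp: AE_completion_iff slice_def[abs_def] case_prod_beta)
    have Sfin': "AE y in lborel. \<theta> < 1 \<longrightarrow> ?S y < \<infinity>" using Sfin by (cases "\<theta> < 1") auto
    define k where "k = ennreal C1 * (k1 \<up> \<rho> * k2 * k3)"
    have "AE y in lborel. \<forall>x3. ennreal \<bar>slice \<phi> y x3\<bar>
        \<le> k * (U1 y \<up> (\<rho> * \<beta>') * U2 y \<up> (\<rho> * \<tau>) * U3 y \<up> (\<rho> * \<eta>))"
      using lim' Sfin' U1(2) U2(2) U3(2)
    proof eventually_elim
      case (elim y)
      have "?A y \<up> \<rho> \<le> k1 \<up> \<rho> * U1 y \<up> (\<rho> * \<beta>')"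
        using rpow_mono[OF elim(3) \<rho>(1)] by (simp add: rpow_mult rpow_rpow mult.commute)
      then have "?A y \<up> \<rho> * pointwise_pow \<theta> \<rho> (?A y) * pointwise_pow (1 - \<theta>) \<rho> (?S y)
          \<le> (k1 \<up> \<rho> * U1 y \<up> (\<rho> * \<beta>')) * (k2 * U2 y \<up> (\<rho> * \<tau>)) * (k3 * U3 y \<up> (\<rho> * \<eta>))"
        using elim by (intro mult_mono) auto
      note le = mult_left_mono[OF this, of "ennreal C1"]
      have "ennreal \<bar>slice \<phi> y x3\<bar> \<le> ennreal C1 * (?A y \<up> \<rho> * pointwise_pow \<theta> \<rho> (?A y) * pointwise_pow (1 - \<theta>) \<rho> (?S y))" for x3
        unfolding C1_def using elim \<rho> assms
        by (intro slice_sup_bound[OF \<phi> \<open>1 \<le> \<alpha>\<close> \<kappa>(1-4) \<open>1 \<le> s\<close> \<sigma> _ _ _ _ rel]) auto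
      then show ?case using le by (auto simp: k_def ac_simps intro: order_trans)
    qed
    note pointwise = this
    have L2f: "square_integral f < \<infinity>"
      using fin(4) by (simp add: L2norm_eq(2) rpow_less_top_iff)
    let ?U = "\<lambda>c. (\<integral>\<^sup>+y. U1 y \<partial>lborel) \<up> (c * (\<rho> * \<beta>')) * (\<integral>\<^sup>+y. U2 y \<partial>lborel) \<up> (c * (\<rho> * \<tau>)) * (\<integral>\<^sup>+y. U3 y \<partial>lborel) \<up> (c * (\<rho> * \<eta>))"
    have "square_integral (\<lambda>x. \<phi> x * f x) \<le> k \<up> 2 * ?U 2 *
        (ennreal C2 * (square_integral f \<up> (1 - 2 * \<rho>) * square_integral (partial e1 f) \<up> \<rho>
          * square_integral (partial e2 f) \<up> \<rho>))"
      using \<rho> \<beta>' \<tau> \<eta> weights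
      by (intro square_integral_product_bound[OF \<rho>(1,2) C2(2) f L2f m(1) U1(1) U2(1) U3(1) _ _ _ weights pointwise]) auto
    from rpow_mono[OF this, of "1 / 2"]
    have "L2norm (\<lambda>x. \<phi> x * f x) \<le> k * ?U 1 *
        (ennreal C2 \<up> (1 / 2) * (L2norm f \<up> (1 - 2 * \<rho>) * L2norm (partial e1 f) \<up> \<rho> * L2norm (partial e2 f) \<up> \<rho>))"
      unfolding L2norm_eq(2) by (simp add: rpow_mult rpow_rpow)
    also have "\<dots> = ennreal C1 * ennreal C2 \<up> (1 / 2) *
        ((k1 \<up> \<rho> * (\<integral>\<^sup>+y. U1 y \<partial>lborel) \<up> (\<rho> * \<beta>')) * (k2 * (\<integral>\<^sup>+y. U2 y \<partial>lborel) \<up> (\<rho> * \<tau>))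
          * (k3 * (\<integral>\<^sup>+y. U3 y \<partial>lborel) \<up> (\<rho> * \<eta>)))
        * (L2norm f \<up> (1 - 2 * \<rho>) * L2norm (partial e1 f) \<up> \<rho> * L2norm (partial e2 f) \<up> \<rho>)"
      by (simp add: k_def ac_simps)
    also have "\<dots> \<le> ennreal C1 * ennreal C2 \<up> (1 / 2) * (?N\<beta> * ?Nt * ?Na)
        * (L2norm f \<up> (1 - 2 * \<rho>) * L2norm (partial e1 f) \<up> \<rho> * L2norm (partial e2 f) \<up> \<rho>)"
      using k1 U2(3) U3(3) by (intro mult_left_mono mult_right_mono mult_mono) auto
    also have "ennreal C1 * ennreal C2 \<up> (1 / 2) = ennreal (C1 * C2 powr (1 / 2))"
      using C1 C2 by (simp add: ennreal_rpow ennreal_mult)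
    finally have "L2norm (\<lambda>x. \<phi> x * f x) \<le> ennreal (C1 * C2 powr (1 / 2)) * (?N\<beta> * ?Nt * ?Na)
        * (L2norm f \<up> (1 - 2 * \<rho>) * L2norm (partial e1 f) \<up> \<rho> * L2norm (partial e2 f) \<up> \<rho>)" .
    from order_trans[OF nn_integral_product_le_L2norm[of "\<lambda>x. \<phi> x * f x" g] mult_right_mono[OF this]]
    have bound: "(\<integral>\<^sup>+x. ennreal \<bar>\<phi> x * f x * g x\<bar> \<partial>lebesgue) \<le> ennreal (C1 * C2 powr (1 / 2)) * ?N\<beta> * ?Nt * ?Na
        * L2norm f \<up> (1 - 2 * \<rho>) * L2norm (partial e1 f) \<up> \<rho> * L2norm (partial e2 f) \<up> \<rho> * L2norm g"
      by (simp add: ac_simps)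
    have "?N\<beta> < \<infinity>" using fin(1) \<rho> by (simp add: epow_eq_rpow rpow_less_top[simplified])
    with fin have "ennreal (C1 * C2 powr (1 / 2)) * ?N\<beta> * ?Nt * ?Na
        * L2norm f \<up> (1 - 2 * \<rho>) * L2norm (partial e1 f) \<up> \<rho> * L2norm (partial e2 f) \<up> \<rho> * L2norm g < \<infinity>"
      by (simp add: ennreal_mult_less_top rpow_less_top[simplified])
    with bound have "(\<integral>\<^sup>+x. ennreal \<bar>\<phi> x * f x * g x\<bar> \<partial>lebesgue) < \<infinity>" by (rule order_le_less_trans)
    then show int: "integrable lebesgue (\<lambda>x. \<phi> x * f x * g x)"
      by (intro integrableI_bounded) auto
    have "ennreal \<bar>\<integral>x. \<phi> x * f x * g x \<partial>lebesgue\<bar> \<le> (\<integral>\<^sup>+x. ennreal \<bar>\<phi> x * f x * g x\<bar> \<partial>lebesgue)"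
      using integral_norm_bound_ennreal[OF int] by simp
    also note bound
    finally show "ennreal \<bar>\<integral>x. \<phi> x * f x * g x \<partial>lebesgue\<bar>
      \<le> ennreal (C1 * C2 powr (1 / 2)) * ?N\<beta> * ?Nt * ?Na
         * epow (L2norm f) (quot_minus r 2)
         * epow (L2norm (partial e1 f)) (1 / r)
         * epow (L2norm (partial e2 f)) (1 / r)
         * L2norm g"
      using \<rho> by (simp add: epow_eq_rpow)
  qed
qed

end
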